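(* Let $\mathbf{T}>0$ and let the $r\times r$ matrix function $k$ on $[-\mathbf{T},\mathbf{T}]$ be an accelerant for the canonical system $$-ij\frac{d}{d\tau}U(\tau,\lambda)=\lambda U(\tau,\lambda)+\begin{bmatrix}0&v(\tau)\\ v(\tau)^*&0\end{bmatrix}U(\tau,\lambda),\qquad 0\le\tau\le\mathbf{T},\qquad j=\begin{bmatrix}I_r&0\\0&-I_r\end{bmatrix},$$ and let $\gamma_\tau(t,s)$ be the corresponding resolvent kernel. For $0\le x\le\mathbf{T}$, $\lambda\in\mathbb{C}$ put $$\ell_1(x,\lambda)=e^{2i\lambda x}\Big(I_r-2\int_0^x e^{-2i\lambda t}k(t)\,dt\Big),\qquad \ell_2(x,\lambda)=e^{2i\lambda x}I_r,$$ and for $0\le\tau\le\mathbf{T}$, $\lambda\in\mathbb{C}$ and $m=1,2$ put $$\theta_m(\tau,\lambda)=\frac{1}{\sqrt2}e^{-i\tau\lambda}\Big\{\ell_m(\tau,\lambda)+\int_0^\tau\gamma_\tau(\tau,s)\ell_m(s,\lambda)\,ds\Big\},$$ $$\omega_m(\tau,\lambda)=\frac{1}{\sqrt2}e^{-i\tau\lambda}\Big\{(-1)^m I_r+\int_0^\tau\gamma_\tau(0,s)\ell_m(s,\lambda)\,ds\Big\}.$$ Then the $2r\times2r$ matrix function $$u(\tau,\lambda)=\begin{bmatrix}\theta_1(\tau,\lambda)&\theta_2(\tau,\lambda)\\ \omega_1(\tau,\lambda)&\omega_2(\tau,\lambda)\end{bmatrix},\qquad 0\le\tau\le\mathbf{T},$$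 is the fundamental solution of the canonical system satisfying the initial condition $$u(0,\lambda)=Q^*,\qquad Q=\frac{1}{\sqrt2}\begin{bmatrix}I_r&-I_r\\ I_r&I_r\end{bmatrix}.$$
   Context: $L^2_r(0,\tau)$ is the space of square integrable $\mathbb{C}^r$-valued functions on $(0,\tau)$. An $r\times r$ matrix function $k$ on $[-\mathbf{T},\mathbf{T}]$ is an accelerant for the canonical system with potential $v$ if: (1) $k$ is hermitian, $k(-t)=k(t)^*$, and continuous on $[-\mathbf{T},\mathbf{T}]$ with possibly a jump discontinuity at the origin (i.e. continuous on $[-\mathbf{T},0)$ and $(0,\mathbf{T}]$ with finite one-sided limits at $0$; on intervals $[0,\tau]$ one takes $k(0)=k(0+)$); (2) for each $0<\tau\le\mathbf{T}$ the operator $(T_\tau f)(t)=f(t)-\int_0^\tau k(t-s)f(s)\,ds$ is invertible on $L^2_r(0,\tau)$; (3) $v$ is the continuous $r\times r$ matrix function on $[0,\mathbf{T}]$ determined by $v(\tau)=-i\gamma_\tau(\tau,0)$ for $0<\tau\le\mathbf{T}$. Here $\gamma_\tau(t,s)$ is the resolvent kernel: $\gamma_\tau(t,s)-\int_0^\tau k(t-\xi)\gamma_\tau(\xi,s)\,d\xi=k(t-s)$ for $0\le t,s\le\tau$; equivalently $(T_\tau^{-1}f)(t)=f(t)+\int_0^\tau\gamma_\tau(t,s)f(s)\,ds$. It is continuous on each of the triangles $0\le s<t\le\tau$ and $0\le t<s\le\tau$, with continuous extension to the closure of each. For $\tau=0$ integrals over $[0,\tau]$ are zero. *)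

theory Defs
  imports "HOL-Analysis.Analysis"
begin

type_synonym 'r cmat = "complex ^ 'r ^ 'r"

definition cscale :: "complex \<Rightarrow> 'r::finite cmat \<Rightarrow> 'r cmat"  (infixr "*\<^sub>C" 75)
  where "c *\<^sub>C A = (\<chi> i j. c * A $ i $ j)"

definition ctranspose :: "'r::finite cmat \<Rightarrow> 'r cmat"
  where "ctranspose A = (\<chi> i j. cnj (A $ j $ i))"

text \<open>The matrices of size $2r \times 2r$ are indexed by the sum type \<^typ>\<open>'r + 'r\<close>.\<close>

definition block :: "'r::finite cmat \<Rightarrow> 'r cmat \<Rightarrow> 'r cmat \<Rightarrow> 'r cmat \<Rightarrow> ('r + 'r) cmat"
  where "block A B C D = (\<chi> i j.
    case i of
      Inl a \<Rightarrow> (case j of Inl b \<Rightarrow> A $ a $ b | Inr b \<Rightarrow> B $ a $ b)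
    | Inr a \<Rightarrow> (case j of Inl b \<Rightarrow> C $ a $ b | Inr b \<Rightarrow> D $ a $ b))"


subsection \<open>Operators on square integrable vector functions\<close>

definition L2 :: "real \<Rightarrow> (real \<Rightarrow> complex ^ 'r::finite) set"
  where "L2 \<tau> = {f. f \<in> borel_measurable (lebesgue_on {0<..<\<tau>}) \<and>
                     integrable (lebesgue_on {0<..<\<tau>}) (\<lambda>t. (norm (f t))\<^sup>2)}"

definition L2norm :: "real \<Rightarrow> (real \<Rightarrow> complex ^ 'r::finite) \<Rightarrow> real"
  where "L2norm \<tau> f = sqrt (integral\<^sup>L (lebesgue_on {0<..<\<tau>}) (\<lambda>t. (norm (f t))\<^sup>2))"

text \<open>
  Elements of \<^const>\<open>L2\<close> are functions, not classes, so the identities $A S = I = S A$ are required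
  almost everywhere. For \<open>A\<close> linear and well defined on classes, these identities together with the
  norm bound force \<open>S\<close> to respect equality almost everywhere and to be linear on classes, so that it
  is the bounded inverse of \<open>A\<close>.
\<close>

definition invertible_on_L2 ::
    "real \<Rightarrow> ((real \<Rightarrow> complex ^ 'r::finite) \<Rightarrow> (real \<Rightarrow> complex ^ 'r)) \<Rightarrow> bool"
  where "invertible_on_L2 \<tau> A \<longleftrightarrow>
    (\<exists>S. (\<forall>f\<in>L2 \<tau>. S f \<in> L2 \<tau> \<and>
              (AE t in lebesgue_on {0<..<\<tau>}. A (S f) t = f t) \<and>
              (AE t in lebesgue_on {0<..<\<tau>}. S (A f) t = f t)) \<and>
         (\<exists>C. \<forall>f\<in>L2 \<tau>. L2norm \<tau> (S f) \<le> C * L2norm \<tau> f))"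

definition conv_op ::
    "(real \<Rightarrow> 'r::finite cmat) \<Rightarrow> real \<Rightarrow> (real \<Rightarrow> complex ^ 'r) \<Rightarrow> (real \<Rightarrow> complex ^ 'r)"
  where "conv_op k \<tau> f = (\<lambda>t. f t - integral\<^sup>L (lebesgue_on {0<..<\<tau>}) (\<lambda>s. k (t - s) *v f s))"


subsection \<open>Resolvent kernels and accelerants\<close>

text \<open>
  The first two conditions say that \<open>\<gamma>\<close> is continuous on each of the triangles $0 \le s < t \le \tau$
  and $0 \le t < s \le \tau$ with a continuous extension to its closure. In particular the integrand
  in the resolvent equation is integrable.
\<close>

definition is_resolvent_kernel ::
    "(real \<Rightarrow> 'r::finite cmat) \<Rightarrow> real \<Rightarrow> (real \<Rightarrow> real \<Rightarrow> 'r cmat) \<Rightarrow> bool"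
  where "is_resolvent_kernel k \<tau> \<gamma> \<longleftrightarrow>
    (\<exists>g. continuous_on {(t, s). 0 \<le> s \<and> s \<le> t \<and> t \<le> \<tau>} g \<and>
         (\<forall>t s. 0 \<le> s \<and> s < t \<and> t \<le> \<tau> \<longrightarrow> g (t, s) = \<gamma> t s)) \<and>
    (\<exists>g. continuous_on {(t, s). 0 \<le> t \<and> t \<le> s \<and> s \<le> \<tau>} g \<and>
         (\<forall>t s. 0 \<le> t \<and> t < s \<and> s \<le> \<tau> \<longrightarrow> g (t, s) = \<gamma> t s)) \<and>
    (\<forall>t\<in>{0..\<tau>}. \<forall>s\<in>{0..\<tau>}.
       \<gamma> t s - integral {0..\<tau>} (\<lambda>\<xi>. k (t - \<xi>) ** \<gamma> \<xi> s) = k (t - s))"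

text \<open>
  Continuity on the closed interval $[0,T]$ encodes the convention $k(0) = k(0+)$. Since
  $k(0-) = k(0+)^*$ may differ from $k(0+)$, hermitian symmetry is only required off the origin.
\<close>

definition is_accelerant ::
    "real \<Rightarrow> (real \<Rightarrow> 'r::finite cmat) \<Rightarrow> (real \<Rightarrow> 'r cmat) \<Rightarrow> bool"
  where "is_accelerant T k v \<longleftrightarrow>
    continuous_on {0..T} k \<and>
    continuous_on {-T..<0} k \<and> (\<exists>L. (k \<longlongrightarrow> L) (at_left 0)) \<and>
    (\<forall>t\<in>{-T..T} - {0}. k (- t) = ctranspose (k t)) \<and>
    (\<forall>\<tau>\<in>{0<..T}. invertible_on_L2 \<tau> (conv_op k \<tau>)) \<and>
    continuous_on {0..T} v \<and>
    (\<forall>\<tau>\<in>{0<..T}. \<exists>\<gamma>. is_resolvent_kernel k \<tau> \<gamma> \<and> v \<tau> = (- \<i>) *\<^sub>C \<gamma> \<tau> 0)"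


subsection \<open>The canonical system\<close>

definition signature_j :: "('r::finite + 'r) cmat"
  where "signature_j = block (mat 1) 0 0 (- mat 1)"

text \<open>At the end points of $[0,T]$ the derivative is one-sided.\<close>

definition solves_canonical ::
    "real \<Rightarrow> (real \<Rightarrow> 'r::finite cmat) \<Rightarrow> complex \<Rightarrow> (real \<Rightarrow> ('r + 'r) cmat) \<Rightarrow> bool"
  where "solves_canonical T v z U \<longleftrightarrow>
    (\<forall>\<tau>\<in>{0..T}. \<exists>D. (U has_vector_derivative D) (at \<tau> within {0..T}) \<and>
       (- \<i>) *\<^sub>C (signature_j ** D) =
         z *\<^sub>C U \<tau> + block 0 (v \<tau>) (ctranspose (v \<tau>)) 0 ** U \<tau>)"

definition fundamental_solution ::
    "real \<Rightarrow> (real \<Rightarrow> 'r::finite cmat) \<Rightarrow> complex \<Rightarrow> (real \<Rightarrow> ('r + 'r) cmat) \<Rightarrow> bool"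
  where "fundamental_solution T v z U \<longleftrightarrow>
    solves_canonical T v z U \<and> (\<forall>\<tau>\<in>{0..T}. invertible (U \<tau>))"

text \<open>"The" fundamental solution with a given initial value: it is also unique on $[0,T]$.\<close>

definition is_the_fundamental_solution ::
    "real \<Rightarrow> (real \<Rightarrow> 'r::finite cmat) \<Rightarrow> complex \<Rightarrow> ('r + 'r) cmat \<Rightarrow>
     (real \<Rightarrow> ('r + 'r) cmat) \<Rightarrow> bool"
  where "is_the_fundamental_solution T v z U0 U \<longleftrightarrow>
    fundamental_solution T v z U \<and> U 0 = U0 \<and>
    (\<forall>W. solves_canonical T v z W \<and> W 0 = U0 \<longrightarrow> (\<forall>\<tau>\<in>{0..T}. W \<tau> = U \<tau>))"

definition Q :: "('r::finite + 'r) cmat"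
  where "Q = (1 / sqrt 2) *\<^sub>R block (mat 1) (- mat 1) (mat 1) (mat 1)"


subsection \<open>The functions built from the accelerant\<close>

definition ell1 :: "(real \<Rightarrow> 'r::finite cmat) \<Rightarrow> real \<Rightarrow> complex \<Rightarrow> 'r cmat"
  where "ell1 k x z = exp (2 * \<i> * z * x) *\<^sub>C
    (mat 1 - 2 *\<^sub>R integral {0..x} (\<lambda>t. exp (- 2 * \<i> * z * t) *\<^sub>C k t))"

definition ell2 :: "real \<Rightarrow> complex \<Rightarrow> 'r::finite cmat"
  where "ell2 x z = exp (2 * \<i> * z * x) *\<^sub>C mat 1"

text \<open>The index \<open>m\<close> ranges over 1 and 2.\<close>

definition ell :: "(real \<Rightarrow> 'r::finite cmat) \<Rightarrow> nat \<Rightarrow> real \<Rightarrow> complex \<Rightarrow> 'r cmat"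
  where "ell k m = (if m = 1 then ell1 k else ell2)"

text \<open>The resolvent kernel $\gamma_\tau(t,s)$ is \<open>\<gamma> \<tau> t s\<close>.\<close>

definition theta ::
    "(real \<Rightarrow> 'r::finite cmat) \<Rightarrow> (real \<Rightarrow> real \<Rightarrow> real \<Rightarrow> 'r cmat) \<Rightarrow> nat \<Rightarrow>
     real \<Rightarrow> complex \<Rightarrow> 'r cmat"
  where "theta k \<gamma> m \<tau> z = (1 / sqrt 2) *\<^sub>R exp (- \<i> * \<tau> * z) *\<^sub>C
    (ell k m \<tau> z + integral {0..\<tau>} (\<lambda>s. \<gamma> \<tau> \<tau> s ** ell k m s z))"

definition omega ::
    "(real \<Rightarrow> 'r::finite cmat) \<Rightarrow> (real \<Rightarrow> real \<Rightarrow> real \<Rightarrow> 'r cmat) \<Rightarrow> nat \<Rightarrow>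
     real \<Rightarrow> complex \<Rightarrow> 'r cmat"
  where "omega k \<gamma> m \<tau> z = (1 / sqrt 2) *\<^sub>R exp (- \<i> * \<tau> * z) *\<^sub>C
    ((- 1) ^ m *\<^sub>C mat 1 + integral {0..\<tau>} (\<lambda>s. \<gamma> \<tau> 0 s ** ell k m s z))"

definition u_sol ::
    "(real \<Rightarrow> 'r::finite cmat) \<Rightarrow> (real \<Rightarrow> real \<Rightarrow> real \<Rightarrow> 'r cmat) \<Rightarrow>
     real \<Rightarrow> complex \<Rightarrow> ('r + 'r) cmat"
  where "u_sol k \<gamma> \<tau> z = block (theta k \<gamma> 1 \<tau> z) (theta k \<gamma> 2 \<tau> z)
                                (omega k \<gamma> 1 \<tau> z) (omega k \<gamma> 2 \<tau> z)"

end

theory Submission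
  imports Defs
begin

text \<open>
  Let \<open>K\<^sub>\<tau>\<close> be convolution with \<open>k\<close> over \<open>[0, \<tau>]\<close>. The invertibility of every \<open>I - K\<^sub>\<tau>\<close> gives lower bounds
  for the supremum norm, uniformly in \<open>\<tau>\<close> by compactness of \<open>[0, T]\<close>. They make the
  columns \<open>P\<^sub>\<tau>(t) = \<gamma>\<^sub>\<tau>(t, 0)\<close> and \<open>Q\<^sub>\<tau>(t) = \<gamma>\<^sub>\<tau>(\<tau> - t, \<tau>)\<close>, which solve \<open>(I - K\<^sub>\<tau>) P\<^sub>\<tau> = k\<close> and the equation
  with \<open>k\<^sup>*\<close> in place of \<open>k\<close>, jointly continuous and yield Krein's formulas
  \<open>\<partial>P\<^sub>\<tau>(t)/\<partial>\<tau> = Q\<^sub>\<tau>(\<tau> - t) P\<^sub>\<tau>(\<tau>)\<close> and \<open>\<partial>Q\<^sub>\<tau>(t)/\<partial>\<tau> = P\<^sub>\<tau>(\<tau> - t) Q\<^sub>\<tau>(\<tau>)\<close>. By hermitian symmetry the rows of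
  \<open>\<gamma>\<^sub>\<tau>\<close> occurring in \<open>\<theta>\<^sub>m\<close> and \<open>\<omega>\<^sub>m\<close> are adjoints of these columns, so both can be differentiated under the
  integral. Invertibility and uniqueness need no estimate: for solutions \<open>W\<close> at \<open>\<lambda>\<close> and \<open>U\<close> at the
  conjugate of \<open>\<lambda>\<close> the form \<open>U\<^sup>* j W\<close> is constant, and it is invertible at \<open>\<tau> = 0\<close>.
\<close>

subsection \<open>Matrices\<close>

text \<open>The invertibility hypothesis concerns vector functions on an interval that changes with
  \<tau>. Every equation is therefore continued from \<open>[0, \<tau>]\<close> to the fixed
  interval \<open>[0, T]\<close>, where solutions for different lengths can be compared. The jump of
  the kernel at the origin is the second obstacle: the value of \<gamma> on the diagonal is never
  compared across the jump, but dropped as a null set.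

  The reflection in Q moves the base point of the last column to 0, so that it solves an equation of
  the same type as the first column; one theory, applied to a kernel and to its adjoint, serves
  both. The potential enters through P_\<tau>(\<tau>) = i v(\<tau>). Up to the exponential
  prefactor, the derivative of \<theta> is 2i\<lambda> \<theta> + P_\<tau>(\<tau>) \<omega> and that
  of \<omega> is the adjoint of P_\<tau>(\<tau>) times \<theta>; the prefactor shifts the
  coefficients 2i\<lambda> and 0 to i\<lambda> and -i\<lambda>. The inhomogeneity -2k in the
  equation of the first function ell is what turns the constant term I of \<omega> into -I.\<close>

lemma norm_matrix_mult_le:
  fixes A :: "complex ^ 'n ^ 'm" and B :: "complex ^ 'p ^ 'n"
  shows "norm (A ** B) \<le> norm A * norm B"
proof -
  have row: "norm ((A ** B) $ i) \<le> norm (A $ i) * norm B" for i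
  proof -
    \<comment> \<open>The norm is the Frobenius norm: a row of the product is a combination of the
      rows of \<open>B\<close>, and Cauchy-Schwarz bounds it.\<close>
    have "(A ** B) $ i = (\<Sum>l\<in>UNIV. A $ i $ l *s B $ l)"
      by (simp add: matrix_matrix_mult_def vec_eq_iff)
    also have "norm \<dots> \<le> (\<Sum>l\<in>UNIV. norm (A $ i $ l *s B $ l))"
      by (rule norm_sum)
    also have "\<dots> = (\<Sum>l\<in>UNIV. \<bar>norm (A $ i $ l)\<bar> * \<bar>norm (B $ l)\<bar>)"
      by (simp add: norm_vec_def L2_set_right_distrib norm_mult)
    also have "\<dots> \<le> norm (A $ i) * norm B"
      unfolding norm_vec_def[of "A $ i"] norm_vec_def[of B] by (rule L2_set_mult_ineq)
    finally show ?thesis .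
  qed
  have "norm (A ** B) \<le> L2_set (\<lambda>i. norm (A $ i) * norm B) UNIV"
    unfolding norm_vec_def[of "A ** B"] by (intro L2_set_mono row) auto
  also have "\<dots> = norm A * norm B"
    by (simp add: norm_vec_def[of A] L2_set_left_distrib)
  finally show ?thesis .
qed

lemma bounded_bilinear_matrix_mult:
  "bounded_bilinear ((**) :: complex ^ 'n ^ 'm \<Rightarrow> complex ^ 'p ^ 'n \<Rightarrow> complex ^ 'p ^ 'm)"
proof
  show "\<exists>K. \<forall>(A :: complex ^ 'n ^ 'm) (B :: complex ^ 'p ^ 'n). norm (A ** B) \<le> norm A * norm B * K"
    by (metis mult.right_neutral norm_matrix_mult_le)
qed (simp_all add: matrix_matrix_mult_def vec_eq_iff algebra_simps sum.distrib scaleR_sum_right)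

lemma bounded_bilinear_cscale:
  "bounded_bilinear ((*\<^sub>C) :: complex \<Rightarrow> 'r::finite cmat \<Rightarrow> 'r cmat)"
proof
  have "norm (c *\<^sub>C A) \<le> norm c * norm A" for c and A :: "'r cmat"
    by (simp add: cscale_def norm_vec_def norm_mult flip: L2_set_right_distrib)
  then show "\<exists>K. \<forall>c (A :: 'r cmat). norm (c *\<^sub>C A) \<le> norm c * norm A * K"
    by (metis mult.right_neutral)
qed (simp_all add: cscale_def vec_eq_iff algebra_simps)

lemma bounded_linear_ctranspose:
  "bounded_linear (ctranspose :: 'r::finite cmat \<Rightarrow> 'r cmat)"
proof -
  have "linear (ctranspose :: 'r cmat \<Rightarrow> 'r cmat)"
    by (rule linearI) (simp_all add: ctranspose_def vec_eq_iff)
  then show ?thesis by (rule linear_conv_bounded_linear[THEN iffD1])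
qed

interpretation mmult: bounded_bilinear
  "(**) :: complex ^ 'n ^ 'm \<Rightarrow> complex ^ 'p ^ 'n \<Rightarrow> complex ^ 'p ^ 'm"
  by (rule bounded_bilinear_matrix_mult)

interpretation cscale: bounded_bilinear "(*\<^sub>C) :: complex \<Rightarrow> 'r::finite cmat \<Rightarrow> 'r cmat"
  by (rule bounded_bilinear_cscale)

lemmas continuous_on_ctranspose = bounded_linear.continuous_on[OF bounded_linear_ctranspose]

lemma ctranspose_simps [simp]:
  "ctranspose (A + B) = ctranspose A + ctranspose B"
  "ctranspose (A - B) = ctranspose A - ctranspose B"
  "ctranspose (- A) = - ctranspose A"
  "ctranspose (c *\<^sub>R A) = c *\<^sub>R ctranspose A"
  "ctranspose 0 = 0"
  by (simp_all add: ctranspose_def vec_eq_iff)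

lemma ctranspose_ctranspose [simp]: "ctranspose (ctranspose A) = A"
  by (simp add: ctranspose_def vec_eq_iff)

lemma ctranspose_mult: "ctranspose (A ** B) = ctranspose B ** ctranspose A"
  by (simp add: ctranspose_def matrix_matrix_mult_def vec_eq_iff mult.commute)

lemma ctranspose_cscale: "ctranspose (c *\<^sub>C A) = cnj c *\<^sub>C ctranspose A"
  by (simp add: ctranspose_def cscale_def vec_eq_iff)

lemma ctranspose_mat_1 [simp]: "ctranspose (mat 1) = mat 1"
  by (simp add: ctranspose_def mat_def vec_eq_iff)

lemma cscale_mult_left: "(c *\<^sub>C A) ** B = c *\<^sub>C (A ** B)"
  by (simp add: cscale_def matrix_matrix_mult_def vec_eq_iff sum_distrib_left mult.assoc)

lemma cscale_mult_right: "A ** (c *\<^sub>C B) = c *\<^sub>C (A ** B)"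
  by (simp add: cscale_def matrix_matrix_mult_def vec_eq_iff sum_distrib_left mult.left_commute)

lemma cscale_cscale: "a *\<^sub>C (b *\<^sub>C A) = (a * b) *\<^sub>C A"
  by (simp add: cscale_def vec_eq_iff)

lemma cscale_one [simp]: "1 *\<^sub>C A = A"
  by (simp add: cscale_def vec_eq_iff)

lemma integral_mmult_left:
  fixes F :: "real \<Rightarrow> complex ^ 'n ^ 'm"
  shows "F integrable_on S \<Longrightarrow> integral S (\<lambda>x. F x ** B) = integral S F ** B"
  using integral_linear[OF _ mmult.bounded_linear_left] by (simp add: o_def)

lemma integral_mmult_right:
  fixes F :: "real \<Rightarrow> complex ^ 'n ^ 'm"
  shows "F integrable_on S \<Longrightarrow> integral S (\<lambda>x. B ** F x) = B ** integral S F"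
  using integral_linear[OF _ mmult.bounded_linear_right] by (simp add: o_def)

lemma integral_ctranspose:
  "F integrable_on S \<Longrightarrow> integral S (\<lambda>x. ctranspose (F x)) = ctranspose (integral S F)"
  using integral_linear[OF _ bounded_linear_ctranspose] by (simp add: o_def)

lemma norm_integral_le_const:
  fixes f :: "real \<Rightarrow> 'a::euclidean_space"
  assumes "f integrable_on {a..b}" "a \<le> b" "\<And>x. x \<in> {a..b} \<Longrightarrow> norm (f x) \<le> B"
  shows "norm (integral {a..b} f) \<le> (b - a) * B"
proof -
  have "norm (integral {a..b} f) \<le> integral {a..b} (\<lambda>x. B)"
    by (intro integral_norm_bound_integral assms) auto
  then show ?thesis using assms by simp
qed

lemma integral_reflect_Icc:
  fixes f :: "real \<Rightarrow> 'a::euclidean_space"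
  shows "integral {0..\<tau>} (\<lambda>s. f (\<tau> - s)) = integral {0..\<tau>} f"
  using Henstock_Kurzweil_Integration.integral_reflect_real[of \<tau> 0 f]
    integral_shift_Icc_real[of 0 \<tau> "\<lambda>s. f (- s)" "-\<tau>"] by (simp add: o_def)

subsection \<open>Convolution with a hermitian kernel\<close>

text \<open>The kernel is rebuilt from its values on the nonnegative half line, so a function
  \<open>A\<close> continuous on the whole line encodes it together with its jump. The branch at 0
  is the convention k(0) = k(0+).\<close>

definition herm_kernel :: "(real \<Rightarrow> 'r::finite cmat) \<Rightarrow> real \<Rightarrow> 'r cmat"
  where "herm_kernel A x = (if 0 \<le> x then A x else ctranspose (A (- x)))"

definition conv :: "(real \<Rightarrow> 'r::finite cmat) \<Rightarrow> real \<Rightarrow> (real \<Rightarrow> 'r cmat) \<Rightarrow> real \<Rightarrow> 'r cmat"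
  where "conv A \<sigma> F t = integral {0..\<sigma>} (\<lambda>s. herm_kernel A (t - s) ** F s)"

abbreviation (input) adj :: "(real \<Rightarrow> 'r::finite cmat) \<Rightarrow> real \<Rightarrow> 'r cmat"
  where "adj A \<equiv> \<lambda>x. ctranspose (A x)"

text \<open>Subtracting the jump at the origin leaves a continuous kernel.\<close>

definition kernel_cont :: "(real \<Rightarrow> 'r::finite cmat) \<Rightarrow> real \<Rightarrow> 'r cmat"
  where "kernel_cont A x = herm_kernel A x - (if 0 \<le> x then A 0 - ctranspose (A 0) else 0)"

lemma continuous_kernel_cont:
  assumes "continuous_on UNIV A"
  shows "continuous_on UNIV (kernel_cont A)"
proof -
  have "continuous_on ({0..} \<union> {..0}) (\<lambda>x. if 0 \<le> x then A x - (A 0 - ctranspose (A 0)) else ctranspose (A (- x)))"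
    by (intro continuous_on_cases)
       (auto intro!: continuous_intros continuous_on_ctranspose continuous_on_subset[OF assms]
             continuous_on_compose2[OF assms] simp: antisym_conv)
  moreover have "{0..} \<union> {..0} = (UNIV :: real set)" by auto
  moreover have "(\<lambda>x. if 0 \<le> x then A x - (A 0 - ctranspose (A 0)) else ctranspose (A (- x))) = kernel_cont A"
    by (auto simp: kernel_cont_def herm_kernel_def)
  ultimately show ?thesis by (simp only:)
qed

lemma herm_kernel_split:
  "herm_kernel A x = kernel_cont A x + (if 0 \<le> x then A 0 - ctranspose (A 0) else 0)"
  by (simp add: kernel_cont_def)

text \<open>The jump contributes a step function, whose convolution with \<open>F\<close> is an
  indefinite integral. In this form both summands are visibly continuous in \<open>t\<close>,
  although the kernel is not.\<close>

lemma conv_split: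
  assumes A: "continuous_on UNIV A" and F: "continuous_on {0..\<sigma>} F" and t: "0 \<le> t"
  shows "(\<lambda>s. herm_kernel A (t - s) ** F s) integrable_on {0..\<sigma>}"
    and "conv A \<sigma> F t = integral {0..\<sigma>} (\<lambda>s. kernel_cont A (t - s) ** F s)
           + (A 0 - ctranspose (A 0)) ** integral {0..min t \<sigma>} F"
proof -
  let ?J = "A 0 - ctranspose (A 0)"
  have c: "(\<lambda>s. kernel_cont A (t - s) ** F s) integrable_on {0..\<sigma>}"
    by (intro integrable_continuous_interval mmult.continuous_on F
          continuous_on_compose2[OF continuous_kernel_cont[OF A]] continuous_intros) auto
  have Fi: "F integrable_on {0..min t \<sigma>}"
    by (intro integrable_continuous_interval continuous_on_subset[OF F]) auto
  have i: "{0..min t \<sigma>} = {0..t} \<inter> {0..\<sigma>}" by auto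
  have "((\<lambda>s. ?J ** F s) has_integral (?J ** integral {0..min t \<sigma>} F)) ({0..t} \<inter> {0..\<sigma>})"
    using has_integral_linear[OF integrable_integral[OF Fi] mmult.bounded_linear_right]
    by (simp only: o_def i)
  then have "((\<lambda>s. if s \<in> {0..t} then ?J ** F s else 0) has_integral (?J ** integral {0..min t \<sigma>} F)) {0..\<sigma>}"
    by (simp only: has_integral_restrict_Int)
  from has_integral_add[OF integrable_integral[OF c] this]
  have "((\<lambda>s. herm_kernel A (t - s) ** F s) has_integral
     (integral {0..\<sigma>} (\<lambda>s. kernel_cont A (t - s) ** F s) + ?J ** integral {0..min t \<sigma>} F)) {0..\<sigma>}"
    by (rule has_integral_eq_rhs[OF has_integral_eq, rotated])
       (auto simp: herm_kernel_split mmult.add_left)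
  then show "(\<lambda>s. herm_kernel A (t - s) ** F s) integrable_on {0..\<sigma>}"
    and "conv A \<sigma> F t = integral {0..\<sigma>} (\<lambda>s. kernel_cont A (t - s) ** F s)
           + (A 0 - ctranspose (A 0)) ** integral {0..min t \<sigma>} F"
    unfolding conv_def by (auto simp: integral_unique)
qed

lemma conv_continuous:
  assumes A: "continuous_on UNIV A" and F: "continuous_on {0..\<sigma>} F" and "0 \<le> \<sigma>"
  shows "continuous_on {0..} (conv A \<sigma> F)"
proof -
  have 1: "continuous_on {0..} (\<lambda>t. integral {0..\<sigma>} (\<lambda>s. kernel_cont A (t - s) ** F s))"
  proof -
    have "continuous_on {0..} (\<lambda>t. integral (cbox 0 \<sigma>) (\<lambda>s. kernel_cont A (t - s) ** F s))"
      by (rule integral_continuous_on_param)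
         (auto simp: split_def intro!: mmult.continuous_on continuous_on_compose2[OF F] continuous_intros
           continuous_on_compose2[OF continuous_kernel_cont[OF A]])
    then show ?thesis by simp
  qed
  have "continuous_on {0..\<sigma>} (\<lambda>x. integral {0..x} F)"
    by (intro indefinite_integral_continuous_1 integrable_continuous_interval F)
  then have 2: "continuous_on {0..} (\<lambda>t. integral {0..min t \<sigma>} F)"
    by (rule continuous_on_compose2) (use assms in \<open>auto intro: continuous_on_min continuous_on_id continuous_on_const\<close>)
  show ?thesis
    by (subst continuous_on_cong[OF refl conv_split(2)[OF A F]])
       (simp, intro continuous_on_add 1 mmult.continuous_on 2 continuous_on_const)
qed

lemma conv_cong:
  assumes "\<And>s. s \<in> {0..\<sigma>} - N \<Longrightarrow> F s = G s" "finite N"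
  shows "conv A \<sigma> F t = conv A \<sigma> G t"
  unfolding conv_def by (rule integral_spike[of N]) (use assms in auto)

text \<open>Reflecting both variables reverses the sign of the difference, which for a hermitian
  kernel means passing to the adjoint. The two kernels can disagree only at the origin, a single
  point of the integral.\<close>

lemma conv_reflect:
  "conv A \<sigma> (\<lambda>s. F (\<sigma> - s)) t = conv (adj A) \<sigma> F (\<sigma> - t)"
proof -
  have "conv A \<sigma> (\<lambda>s. F (\<sigma> - s)) t = integral {0..\<sigma>} (\<lambda>s. herm_kernel A (t - (\<sigma> - s)) ** F s)"
    using integral_reflect_Icc[of \<sigma> "\<lambda>s. herm_kernel A (t - (\<sigma> - s)) ** F s"] by (simp add: conv_def)
  also have "\<dots> = conv (adj A) \<sigma> F (\<sigma> - t)"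
    unfolding conv_def
    by (rule integral_spike[of "{\<sigma> - t}"]) (auto simp: herm_kernel_def algebra_simps)
  finally show ?thesis .
qed

subsection \<open>Lower bounds uniform in the length of the interval\<close>

lemma herm_kernel_bounded:
  assumes "continuous_on UNIV A"
  obtains \<kappa> where "0 \<le> \<kappa>" "\<And>x. x \<in> {-T..T} \<Longrightarrow> norm (herm_kernel A x) \<le> \<kappa>"
proof -
  have "compact (A ` {0..T} \<union> adj A ` {0..T})"
    by (intro compact_Un compact_continuous_image continuous_on_ctranspose continuous_on_subset[OF assms]) auto
  then have "bounded (A ` {0..T} \<union> adj A ` {0..T})"
    by (rule compact_imp_bounded)
  then obtain \<kappa> where "\<forall>X \<in> A ` {0..T} \<union> adj A ` {0..T}. norm X \<le> \<kappa>"
    unfolding bounded_iff by blast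
  then have "\<kappa> \<le> max \<kappa> 0" "norm (herm_kernel A x) \<le> \<kappa>" if "x \<in> {-T..T}" for x
    using that by (auto simp: herm_kernel_def)
  then have "norm (herm_kernel A x) \<le> max \<kappa> 0" if "x \<in> {-T..T}" for x
    using that by (meson order_trans)
  moreover have "0 \<le> max \<kappa> 0" by simp
  ultimately show ?thesis using that by metis
qed

lemma conv_combine:
  assumes A: "continuous_on UNIV A" and F: "continuous_on {0..\<tau>} F" and "0 \<le> \<sigma>" "\<sigma> \<le> \<tau>" "0 \<le> t"
  shows "conv A \<tau> F t = conv A \<sigma> F t + integral {\<sigma>..\<tau>} (\<lambda>s. herm_kernel A (t - s) ** F s)"
  unfolding conv_def
  by (rule Henstock_Kurzweil_Integration.integral_combine[symmetric])
     (use assms conv_split(1)[OF A F] in auto)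

text \<open>The factor \<open>b - a\<close> makes convolution Lipschitz in its end point; with
  \<open>a = 0\<close> the same estimate bounds the convolution itself.\<close>

lemma norm_kernel_integral_le:
  fixes F :: "real \<Rightarrow> 'r::finite cmat"
  assumes A: "continuous_on UNIV A" and F: "continuous_on {0..b} F" and "0 \<le> a" "a \<le> b" "b \<le> T" "t \<in> {0..T}"
    and \<kappa>: "0 \<le> \<kappa>" "\<And>x. x \<in> {-T..T} \<Longrightarrow> norm (herm_kernel A x) \<le> \<kappa>"
    and M: "\<And>s. s \<in> {a..b} \<Longrightarrow> norm (F s) \<le> M"
  shows "norm (integral {a..b} (\<lambda>s. herm_kernel A (t - s) ** F s)) \<le> (b - a) * (\<kappa> * M)"
proof (rule norm_integral_le_const)
  show "(\<lambda>s. herm_kernel A (t - s) ** F s) integrable_on {a..b}"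
    by (rule integrable_on_subinterval[OF conv_split(1)[OF A F]]) (use assms in auto)
  show "norm (herm_kernel A (t - s) ** F s) \<le> \<kappa> * M" if "s \<in> {a..b}" for s
    by (rule order_trans[OF norm_matrix_mult_le])
       (use that assms in \<open>auto intro!: mult_mono \<kappa> M\<close>)
qed (use assms in auto)

section \<open>Continuous functions as square integrable functions\<close>

text \<open>Invertibility is phrased with Lebesgue integrals over the open interval, the rest of the
  argument with gauge integrals over the closed one. For bounded functions the two agree.\<close>

lemma lebesgue_open_interval:
  fixes f :: "real \<Rightarrow> 'a::euclidean_space"
  assumes "f integrable_on {0..\<sigma>}" "\<And>x. x \<in> {0..\<sigma>} \<Longrightarrow> norm (f x) \<le> B"
  shows "integrable (lebesgue_on {0<..<\<sigma>}) f"
    and "integral\<^sup>L (lebesgue_on {0<..<\<sigma>}) f = integral {0..\<sigma>} f"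
proof -
  have "f absolutely_integrable_on {0..\<sigma>}"
    by (rule absolutely_integrable_integrable_bound[where g = "\<lambda>_. B"]) (use assms in auto)
  then have "f absolutely_integrable_on {0<..<\<sigma>}"
    by (rule set_integrable_subset) auto
  then show i: "integrable (lebesgue_on {0<..<\<sigma>}) f"
    by (rule absolutely_integrable_imp_integrable) auto
  have "integral\<^sup>L (lebesgue_on {0<..<\<sigma>}) f = integral {0<..<\<sigma>} f"
    by (rule lebesgue_integral_eq_integral[OF i]) auto
  then show "integral\<^sup>L (lebesgue_on {0<..<\<sigma>}) f = integral {0..\<sigma>} f"
    by (simp add: integral_open_interval_real)
qed

lemma lebesgue_open_interval_continuous:
  fixes f :: "real \<Rightarrow> 'a::euclidean_space"
  assumes "continuous_on {0..\<sigma>} f"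
  shows "integrable (lebesgue_on {0<..<\<sigma>}) f"
    and "integral\<^sup>L (lebesgue_on {0<..<\<sigma>}) f = integral {0..\<sigma>} f"
proof -
  have "bounded (f ` {0..\<sigma>})"
    by (intro compact_imp_bounded compact_continuous_image assms) auto
  then obtain B where "\<And>x. x \<in> {0..\<sigma>} \<Longrightarrow> norm (f x) \<le> B"
    unfolding bounded_iff by blast
  from lebesgue_open_interval[OF integrable_continuous_interval[OF assms] this]
  show "integrable (lebesgue_on {0<..<\<sigma>}) f"
    and "integral\<^sup>L (lebesgue_on {0<..<\<sigma>}) f = integral {0..\<sigma>} f" by auto
qed

lemma continuous_in_L2:
  fixes f :: "real \<Rightarrow> complex ^ 'r::finite"
  assumes "continuous_on {0..\<sigma>} f"
  shows "f \<in> L2 \<sigma>" and "(L2norm \<sigma> f)\<^sup>2 = integral {0..\<sigma>} (\<lambda>t. (norm (f t))\<^sup>2)"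
proof -
  have c: "continuous_on {0..\<sigma>} (\<lambda>t. (norm (f t))\<^sup>2)"
    by (intro continuous_intros assms)
  show "f \<in> L2 \<sigma>"
    using lebesgue_open_interval_continuous(1)[OF c] lebesgue_open_interval_continuous(1)[OF assms]
    by (simp add: L2_def borel_measurable_integrable)
  have "0 \<le> integral {0..\<sigma>} (\<lambda>t. (norm (f t))\<^sup>2)"
    by (intro integral_nonneg integrable_continuous_interval c) auto
  then show "(L2norm \<sigma> f)\<^sup>2 = integral {0..\<sigma>} (\<lambda>t. (norm (f t))\<^sup>2)"
    by (simp add: L2norm_def lebesgue_open_interval_continuous(2)[OF c])
qed

lemma L2norm_cong_AE:
  assumes "f \<in> L2 \<sigma>" "g \<in> L2 \<sigma>" "AE t in lebesgue_on {0<..<\<sigma>}. f t = g t"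
  shows "L2norm \<sigma> f = L2norm \<sigma> g"
proof -
  have "integral\<^sup>L (lebesgue_on {0<..<\<sigma>}) (\<lambda>t. (norm (f t))\<^sup>2) = integral\<^sup>L (lebesgue_on {0<..<\<sigma>}) (\<lambda>t. (norm (g t))\<^sup>2)"
    by (rule integral_cong_AE) (use assms in \<open>auto simp: L2_def\<close>)
  then show ?thesis by (simp add: L2norm_def)
qed

text \<open>Since \<open>f\<close> equals \<open>S (A f)\<close> almost everywhere, the norm bound
  on \<open>S\<close> estimates \<open>f\<close> by \<open>A f\<close>. Agreement of
  \<open>A f\<close> with a continuous \<open>g\<close> inside the interval also provides the
  membership of \<open>A f\<close> in \<open>L2\<close>.\<close>

lemma invertible_on_L2_lower_bound:
  fixes A :: "(real \<Rightarrow> complex ^ 'r::finite) \<Rightarrow> real \<Rightarrow> complex ^ 'r"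
  assumes "invertible_on_L2 \<sigma> A"
  obtains C where "0 \<le> C" "\<And>f g. continuous_on {0..\<sigma>} f \<Longrightarrow> continuous_on {0..\<sigma>} g \<Longrightarrow>
      (\<And>t. t \<in> {0<..<\<sigma>} \<Longrightarrow> A f t = g t) \<Longrightarrow>
      integral {0..\<sigma>} (\<lambda>t. (norm (f t))\<^sup>2) \<le> C * integral {0..\<sigma>} (\<lambda>t. (norm (g t))\<^sup>2)"
proof -
  from assms obtain S C where
    S: "\<And>f. f \<in> L2 \<sigma> \<Longrightarrow> S f \<in> L2 \<sigma> \<and> (AE t in lebesgue_on {0<..<\<sigma>}. S (A f) t = f t)"
    and C: "\<And>f. f \<in> L2 \<sigma> \<Longrightarrow> L2norm \<sigma> (S f) \<le> C * L2norm \<sigma> f"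
    unfolding invertible_on_L2_def by blast
  have "integral {0..\<sigma>} (\<lambda>t. (norm (f t))\<^sup>2) \<le> C\<^sup>2 * integral {0..\<sigma>} (\<lambda>t. (norm (g t))\<^sup>2)"
    if f: "continuous_on {0..\<sigma>} f" and g: "continuous_on {0..\<sigma>} g"
      and eq: "\<And>t. t \<in> {0<..<\<sigma>} \<Longrightarrow> A f t = g t" for f g
  proof -
    note gL = continuous_in_L2[OF g] and fL = continuous_in_L2[OF f]
    have AE: "AE t in lebesgue_on {0<..<\<sigma>}. A f t = g t"
      by (rule AE_I2) (use eq in auto)
    have AfL: "A f \<in> L2 \<sigma>"
    proof -
      have "A f \<in> borel_measurable (lebesgue_on {0<..<\<sigma>}) \<longleftrightarrow> g \<in> borel_measurable (lebesgue_on {0<..<\<sigma>})"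
        by (rule measurable_cong) (use eq in auto)
      moreover have "integrable (lebesgue_on {0<..<\<sigma>}) (\<lambda>t. (norm (A f t))\<^sup>2)
          \<longleftrightarrow> integrable (lebesgue_on {0<..<\<sigma>}) (\<lambda>t. (norm (g t))\<^sup>2)"
        by (rule Bochner_Integration.integrable_cong) (use eq in auto)
      ultimately show ?thesis using gL(1) by (simp add: L2_def)
    qed
    have "L2norm \<sigma> f = L2norm \<sigma> (S (A f))"
      by (rule L2norm_cong_AE) (use S[OF AfL] S[OF fL(1)] fL(1) in \<open>auto elim: eventually_mono\<close>)
    also have "\<dots> \<le> C * L2norm \<sigma> (A f)" by (rule C[OF AfL])
    also have "L2norm \<sigma> (A f) = L2norm \<sigma> g" by (rule L2norm_cong_AE[OF AfL gL(1) AE])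
    finally have "(L2norm \<sigma> f)\<^sup>2 \<le> (C * L2norm \<sigma> g)\<^sup>2"
      by (rule power_mono) (simp add: L2norm_def)
    then show ?thesis by (simp add: fL(2) gL(2) power_mult_distrib)
  qed
  \<comment> \<open>The square is nonnegative whatever the sign of the constant in the definition of
    invertibility.\<close>
  then show ?thesis using that[of "C\<^sup>2"] by simp
qed

section \<open>Columns: from vector functions to matrix functions\<close>

lemma bounded_linear_column: "bounded_linear (column j :: 'r::finite cmat \<Rightarrow> complex ^ 'r)"
proof -
  have "linear (column j :: 'r cmat \<Rightarrow> complex ^ 'r)"
    by (rule linearI) (simp_all add: column_def vec_eq_iff)
  then show ?thesis by (rule linear_conv_bounded_linear[THEN iffD1])
qed

lemma column_mult: "column j (A ** B) = A *v column j B"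
  by (simp add: column_def matrix_matrix_mult_def matrix_vector_mult_def vec_eq_iff)

lemma norm_column_le: "norm (column j X) \<le> norm (X :: 'r::finite cmat)"
  unfolding norm_vec_def[of X] norm_vec_def[of "column j X"]
  by (rule L2_set_mono) (auto simp: column_def Finite_Cartesian_Product.norm_nth_le)

lemma norm_le_sum_columns: "norm (X :: 'r::finite cmat) \<le> (\<Sum>j\<in>UNIV. norm (column j X))"
proof -
  have "X = (\<Sum>j\<in>UNIV. \<chi> i l. if l = j then X $ i $ l else 0)"
    by (simp add: vec_eq_iff)
  also have "norm \<dots> \<le> (\<Sum>j\<in>UNIV. norm (\<chi> i l. if l = j then X $ i $ l else 0))"
    by (rule norm_sum)
  also have "\<dots> = (\<Sum>j\<in>UNIV. norm (column j X))"
  proof (rule sum.cong[OF refl])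
    fix j
    have "L2_set (\<lambda>l. cmod (if l = j then X $ i $ l else 0)) UNIV = cmod (X $ i $ j)" for i
    proof -
      have "(\<Sum>l\<in>UNIV. (cmod (if l = j then X $ i $ l else 0))\<^sup>2) = (\<Sum>l\<in>UNIV. if l = j then (cmod (X $ i $ l))\<^sup>2 else 0)"
        by (rule sum.cong) auto
      then show ?thesis by (simp add: L2_set_def)
    qed
    then show "norm (\<chi> i l. if l = j then X $ i $ l else 0) = norm (column j X)"
      by (simp add: norm_vec_def column_def)
  qed
  finally show ?thesis .
qed

section \<open>Bounds in the supremum norm\<close>

text \<open>
  Here \<^term>\<open>conv A \<sigma>\<close> acts on functions on all of \<open>[0, T]\<close>, not only on \<open>[0, \<sigma>]\<close>. On this fixed space
  it is Lipschitz in \<open>\<sigma>\<close> for the operator norm, so lower bounds persist for nearby values of \<open>\<sigma>\<close>.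
\<close>

definition sup_bound :: "(real \<Rightarrow> 'r::finite cmat) \<Rightarrow> real \<Rightarrow> real \<Rightarrow> real \<Rightarrow> bool"
  where "sup_bound A T C \<sigma> \<longleftrightarrow> (\<forall>F h. continuous_on {0..T} F \<longrightarrow> 0 < h \<longrightarrow>
    (\<forall>t\<in>{0..T}. norm (F t - conv A \<sigma> F t) \<le> h) \<longrightarrow> (\<forall>t\<in>{0..T}. norm (F t) \<le> C * h))"

lemma sup_bound_mono:
  assumes "sup_bound A T C \<sigma>" "C \<le> D"
  shows "sup_bound A T D \<sigma>"
  using assms unfolding sup_bound_def by (meson less_imp_le mult_right_mono order_trans)

text \<open>The bound in mean square, applied column by column, controls the integral of the norm of
  \<open>F\<close> over \<open>[0, \<sigma>]\<close>. Writing \<open>F\<close> as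
  \<open>F - conv A \<sigma> F\<close> plus \<open>conv A \<sigma> F\<close> and bounding the kernel
  by \<kappa> promotes this to a pointwise bound, also at points beyond \<sigma>.\<close>

lemma sup_bound_if_invertible_on_L2:
  fixes A :: "real \<Rightarrow> 'r::finite cmat"
  assumes A: "continuous_on UNIV A" and \<sigma>: "0 < \<sigma>" "\<sigma> \<le> T"
    and k: "\<And>x. x \<in> {-T..T} \<Longrightarrow> k x = herm_kernel A x"
    and inv: "invertible_on_L2 \<sigma> (conv_op k \<sigma>)"
  shows "\<exists>C\<ge>0. sup_bound A T C \<sigma>"
proof -
  obtain \<kappa> where \<kappa>: "0 \<le> \<kappa>" "\<And>x. x \<in> {-T..T} \<Longrightarrow> norm (herm_kernel A x) \<le> \<kappa>"
    using herm_kernel_bounded[OF A] by blast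
  obtain C where C: "0 \<le> C" "\<And>f g. continuous_on {0..\<sigma>} f \<Longrightarrow> continuous_on {0..\<sigma>} g \<Longrightarrow>
      (\<And>t. t \<in> {0<..<\<sigma>} \<Longrightarrow> conv_op k \<sigma> f t = g t) \<Longrightarrow>
      integral {0..\<sigma>} (\<lambda>t. (norm (f t))\<^sup>2) \<le> C * integral {0..\<sigma>} (\<lambda>t. (norm (g t))\<^sup>2)"
    using invertible_on_L2_lower_bound[OF inv] by blast
  \<comment> \<open>With |f| \<le> |f|^2/(2h) + h/2 and the bound C \<sigma> h^2 on the integral of
    |f|^2, the integral of |f| is at most C \<sigma> h/2 + \<sigma> h/2 = D h.\<close>
  define D where "D = (C + 1) * \<sigma> / 2"
  have "norm (F t) \<le> (1 + \<kappa> * (CARD('r) * D)) * h"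
    if F: "continuous_on {0..T} F" and h: "0 < h"
      and le: "\<And>t. t \<in> {0..T} \<Longrightarrow> norm (F t - conv A \<sigma> F t) \<le> h" and t: "t \<in> {0..T}" for F h t
  proof -
    have F\<sigma>: "continuous_on {0..\<sigma>} F"
      by (rule continuous_on_subset[OF F]) (use \<sigma> in auto)
    obtain M where M: "\<And>s. s \<in> {0..\<sigma>} \<Longrightarrow> norm (F s) \<le> M" "0 \<le> M"
    proof -
      have "bounded (F ` {0..\<sigma>})"
        by (intro compact_imp_bounded compact_continuous_image F\<sigma>) auto
      then obtain M where "\<And>s. s \<in> {0..\<sigma>} \<Longrightarrow> norm (F s) \<le> M"
        unfolding bounded_iff by blast
      with that[of "max M 0"] show ?thesis by (meson max.coboundedI1 max.cobounded2)
    qed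
    have nker: "norm (herm_kernel A (t - s) ** F s) \<le> \<kappa> * norm (F s)" if "t \<in> {0..T}" "s \<in> {0..\<sigma>}" for t s
      by (rule order_trans[OF norm_matrix_mult_le])
         (use that \<sigma> in \<open>auto intro!: mult_right_mono \<kappa>\<close>)
    have col: "integral {0..\<sigma>} (\<lambda>s. norm (column j (F s))) \<le> D * h" for j
    proof -
      define f where "f = (\<lambda>t. column j (F t))"
      define g where "g = (\<lambda>t. column j (F t - conv A \<sigma> F t))"
      have cf: "continuous_on {0..\<sigma>} f"
        unfolding f_def by (rule bounded_linear.continuous_on[OF bounded_linear_column F\<sigma>])
      have cg: "continuous_on {0..\<sigma>} g"
        unfolding g_def
        by (intro bounded_linear.continuous_on[OF bounded_linear_column] continuous_on_diff F\<sigma>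
              continuous_on_subset[OF conv_continuous[OF A F\<sigma>]]) (use \<sigma> in auto)
      have eq: "conv_op k \<sigma> f t = g t" if "t \<in> {0<..<\<sigma>}" for t
      proof -
        have t: "t \<in> {0..T}" using that \<sigma> by auto
        let ?K = "\<lambda>s. column j (herm_kernel A (t - s) ** F s)"
        have I: "(\<lambda>s. herm_kernel A (t - s) ** F s) integrable_on {0..\<sigma>}"
          by (rule conv_split(1)[OF A F\<sigma>]) (use t in auto)
        have "norm (?K s) \<le> \<kappa> * M" if "s \<in> {0..\<sigma>}" for s
          using order_trans[OF norm_column_le nker[OF t that]] mult_left_mono[OF M(1)[OF that] \<kappa>(1)]
          by (rule order_trans)
        then have "integral\<^sup>L (lebesgue_on {0<..<\<sigma>}) ?K = integral {0..\<sigma>} ?K"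
          by (intro lebesgue_open_interval(2) integrable_linear[OF I bounded_linear_column, unfolded o_def])
        also have "\<dots> = column j (conv A \<sigma> F t)"
          using integral_linear[OF I bounded_linear_column] by (simp add: o_def conv_def)
        also have "integral\<^sup>L (lebesgue_on {0<..<\<sigma>}) ?K = integral\<^sup>L (lebesgue_on {0<..<\<sigma>}) (\<lambda>s. k (t - s) *v f s)"
          by (rule Bochner_Integration.integral_cong)
             (use that \<sigma> in \<open>auto simp: f_def column_mult k\<close>)
        finally show ?thesis
          by (simp add: conv_op_def g_def f_def linear_diff[OF bounded_linear.linear[OF bounded_linear_column]])
      qed
      have "integral {0..\<sigma>} (\<lambda>t. (norm (g t))\<^sup>2) \<le> integral {0..\<sigma>} (\<lambda>t. h\<^sup>2)"
      proof (rule integral_le)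
        show "(norm (g s))\<^sup>2 \<le> h\<^sup>2" if "s \<in> {0..\<sigma>}" for s
          unfolding g_def
          by (intro power_mono order_trans[OF norm_column_le le]) (use that \<sigma> in auto)
      qed (auto intro!: integrable_continuous_interval continuous_intros cg)
      then have g2: "integral {0..\<sigma>} (\<lambda>t. (norm (g t))\<^sup>2) \<le> \<sigma> * h\<^sup>2"
        using \<sigma> by simp
      have f2: "integral {0..\<sigma>} (\<lambda>t. (norm (f t))\<^sup>2) \<le> C * (\<sigma> * h\<^sup>2)"
        using C(2)[OF cf cg eq] mult_left_mono[OF g2 C(1)] by linarith
      have i2: "(\<lambda>t. (norm (f t))\<^sup>2) integrable_on {0..\<sigma>}"
        by (intro integrable_continuous_interval continuous_intros cf)
      \<comment> \<open>AM-GM turns the bound on the integral of \<open>|f|\<^sup>2\<close> into one that is linear in \<open>h\<close>.\<close>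
      have "integral {0..\<sigma>} (\<lambda>s. norm (f s)) \<le> integral {0..\<sigma>} (\<lambda>s. (norm (f s))\<^sup>2 * inverse (2 * h) + h / 2)"
      proof (rule integral_le)
        show "norm (f s) \<le> (norm (f s))\<^sup>2 * inverse (2 * h) + h / 2" for s
          using h zero_le_power2[of "norm (f s) - h"] by (simp add: field_simps power2_eq_square)
      qed (auto intro!: integrable_continuous_interval continuous_intros cf)
      also have "\<dots> = integral {0..\<sigma>} (\<lambda>s. (norm (f s))\<^sup>2) * inverse (2 * h) + \<sigma> * (h / 2)"
        using \<sigma> by (subst Henstock_Kurzweil_Integration.integral_add) (auto intro!: integrable_on_mult_left i2)
      also have "\<dots> \<le> (C * (\<sigma> * h\<^sup>2)) * inverse (2 * h) + \<sigma> * (h / 2)"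
        by (intro add_right_mono mult_right_mono f2) (use h in auto)
      also have "\<dots> = D * h"
        using h by (simp add: D_def field_simps power2_eq_square)
      finally show ?thesis by (simp add: f_def)
    qed
    have ci: "(\<lambda>s. norm (column j (F s))) integrable_on {0..\<sigma>}" for j
      by (intro integrable_continuous_interval continuous_on_norm bounded_linear.continuous_on[OF bounded_linear_column F\<sigma>])
    have "norm (conv A \<sigma> F t) \<le> integral {0..\<sigma>} (\<lambda>s. \<kappa> * (\<Sum>j\<in>UNIV. norm (column j (F s))))"
      unfolding conv_def
    proof (rule integral_norm_bound_integral)
      show "(\<lambda>s. herm_kernel A (t - s) ** F s) integrable_on {0..\<sigma>}"
        by (rule conv_split(1)[OF A F\<sigma>]) (use t in auto)
      show "(\<lambda>s. \<kappa> * (\<Sum>j\<in>UNIV. norm (column j (F s)))) integrable_on {0..\<sigma>}"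
        by (intro integrable_on_mult_right integrable_sum ci) auto
      show "norm (herm_kernel A (t - s) ** F s) \<le> \<kappa> * (\<Sum>j\<in>UNIV. norm (column j (F s)))" if "s \<in> {0..\<sigma>}" for s
        using nker[OF t that] mult_left_mono[OF norm_le_sum_columns \<kappa>(1)] by (rule order_trans)
    qed
    also have "\<dots> = \<kappa> * (\<Sum>j\<in>UNIV. integral {0..\<sigma>} (\<lambda>s. norm (column j (F s))))"
      by (simp add: Henstock_Kurzweil_Integration.integral_sum ci)
    also have "\<dots> \<le> \<kappa> * (\<Sum>j\<in>(UNIV :: 'r set). D * h)"
      by (intro mult_left_mono sum_mono col \<kappa>)
    also have "\<dots> = \<kappa> * (CARD('r) * D) * h" by simp
    finally have "norm (conv A \<sigma> F t) \<le> \<kappa> * (CARD('r) * D) * h" .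
    moreover have "norm (F t) \<le> norm (F t - conv A \<sigma> F t) + norm (conv A \<sigma> F t)"
      by (metis diff_add_cancel norm_triangle_ineq)
    ultimately show ?thesis using le[OF t] by (simp add: algebra_simps)
  qed
  then have "sup_bound A T (1 + \<kappa> * (CARD('r) * D)) \<sigma>"
    unfolding sup_bound_def by blast
  moreover have "0 \<le> 1 + \<kappa> * (CARD('r) * D)"
    using \<kappa>(1) C(1) \<sigma> by (simp add: D_def)
  ultimately show ?thesis by blast
qed

text \<open>Invertibility is assumed for positive lengths only; the compactness argument on
  \<open>[0, T]\<close> needs the length 0 too, where the operator is the identity.\<close>

lemma sup_bound_zero: "sup_bound A T 1 0"
  unfolding sup_bound_def conv_def by simp

text \<open>A perturbation argument: replacing \<tau> by \<sigma> costs at most half the maximum of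
  \<open>F\<close>, which is absorbed on the left and doubles the constant.\<close>

lemma sup_bound_nearby:
  assumes A: "continuous_on UNIV A" and \<sigma>: "\<sigma> \<in> {0..T}" and b: "sup_bound A T C \<sigma>" and C: "0 \<le> C"
  shows "\<exists>\<delta>>0. \<forall>\<tau>\<in>{0..T}. \<bar>\<tau> - \<sigma>\<bar> < \<delta> \<longrightarrow> sup_bound A T (2 * C) \<tau>"
proof -
  obtain \<kappa> where \<kappa>: "0 \<le> \<kappa>" "\<And>x. x \<in> {-T..T} \<Longrightarrow> norm (herm_kernel A x) \<le> \<kappa>"
    using herm_kernel_bounded[OF A] by blast
  \<comment> \<open>Chosen so that C \<delta> \<kappa> \<le> 1/2; the added 1 keeps the denominator
    positive.\<close>
  define \<delta> where "\<delta> = 1 / (2 * (C * \<kappa> + 1))"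
  have d0: "0 < \<delta>" using C \<kappa>(1) by (simp add: \<delta>_def add_nonneg_pos)
  have dl: "C * (\<delta> * \<kappa>) \<le> 1 / 2"
  proof -
    have "0 \<le> C * \<kappa>" using C \<kappa>(1) by simp
    then have "(C * \<kappa>) / (2 * (C * \<kappa> + 1)) \<le> 1 / 2" by (simp add: divide_le_eq)
    then show ?thesis by (simp add: \<delta>_def)
  qed
  have "norm (F t) \<le> 2 * C * h"
    if \<tau>: "\<tau> \<in> {0..T}" "\<bar>\<tau> - \<sigma>\<bar> < \<delta>" and F: "continuous_on {0..T} F" and h: "0 < h"
      and le: "\<And>t. t \<in> {0..T} \<Longrightarrow> norm (F t - conv A \<tau> F t) \<le> h" and t: "t \<in> {0..T}" for \<tau> F h t
  proof -
    \<comment> \<open>The maximum is attained, so the estimate at \<open>m\<close> bounds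
      \<open>?M\<close> by a multiple of itself and can be solved for \<open>?M\<close>.\<close>
    obtain m where m: "m \<in> {0..T}" "\<And>s. s \<in> {0..T} \<Longrightarrow> norm (F s) \<le> norm (F m)"
      using continuous_attains_sup[of "{0..T}" "\<lambda>s. norm (F s)"] continuous_on_norm[OF F] t by auto
    let ?M = "norm (F m)"
    have diff: "norm (conv A \<tau> F s - conv A \<sigma> F s) \<le> \<delta> * (\<kappa> * ?M)" if s: "s \<in> {0..T}" for s
    proof -
      have *: "norm (conv A b F s - conv A a F s) \<le> \<delta> * (\<kappa> * ?M)"
        if "0 \<le> a" "a \<le> b" "b \<le> T" "b - a < \<delta>" for a b
      proof -
        have c: "continuous_on {0..b} F" by (rule continuous_on_subset[OF F]) (use that in auto)
        have "norm (conv A b F s - conv A a F s) \<le> (b - a) * (\<kappa> * ?M)"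
          using conv_combine[OF A c, of a s] norm_kernel_integral_le[OF A c, of a T s \<kappa> ?M] that s \<kappa> m by auto
        also have "\<dots> \<le> \<delta> * (\<kappa> * ?M)"
          using that \<kappa>(1) by (intro mult_right_mono) auto
        finally show ?thesis .
      qed
      show ?thesis
        using *[of \<sigma> \<tau>] *[of \<tau> \<sigma>] \<tau> \<sigma> by (cases "\<sigma> \<le> \<tau>") (auto simp: norm_minus_commute)
    qed
    have "norm (F s - conv A \<sigma> F s) \<le> h + \<delta> * (\<kappa> * ?M)" if s: "s \<in> {0..T}" for s
    proof -
      have "norm (F s - conv A \<sigma> F s) \<le> norm (F s - conv A \<tau> F s) + norm (conv A \<tau> F s - conv A \<sigma> F s)"
        using norm_triangle_ineq[of "F s - conv A \<tau> F s" "conv A \<tau> F s - conv A \<sigma> F s"] by simp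
      then show ?thesis using le[OF s] diff[OF s] by linarith
    qed
    then have "?M \<le> C * (h + \<delta> * (\<kappa> * ?M))"
      using b[unfolded sup_bound_def, rule_format, OF F, of "h + \<delta> * (\<kappa> * ?M)" m] m(1) h d0 \<kappa>(1)
      by (simp add: add_pos_nonneg)
    also have "\<dots> \<le> C * h + (1 / 2) * ?M"
      using mult_right_mono[OF dl, of ?M] by (simp add: algebra_simps)
    finally show ?thesis using m(2)[OF t] by linarith
  qed
  then show ?thesis using d0 unfolding sup_bound_def by blast
qed

lemma sup_bound_uniform:
  assumes A: "continuous_on UNIV A"
    and b: "\<And>\<sigma>. \<sigma> \<in> {0..T} \<Longrightarrow> \<exists>C\<ge>0. sup_bound A T C \<sigma>"
  shows "\<exists>C\<ge>0. \<forall>\<sigma>\<in>{0..T}. sup_bound A T C \<sigma>"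
proof -
  have "\<exists>C \<delta>. 0 \<le> C \<and> 0 < \<delta> \<and> (\<forall>\<tau>\<in>{0..T}. \<bar>\<tau> - \<sigma>\<bar> < \<delta> \<longrightarrow> sup_bound A T C \<tau>)" if "\<sigma> \<in> {0..T}" for \<sigma>
  proof -
    obtain C where C: "0 \<le> C" "sup_bound A T C \<sigma>" using b[OF \<open>\<sigma> \<in> {0..T}\<close>] by blast
    with sup_bound_nearby[OF A \<open>\<sigma> \<in> {0..T}\<close> C(2,1)] show ?thesis
      by (metis mult_nonneg_nonneg zero_le_numeral)
  qed
  then obtain C \<delta> where C: "\<And>\<sigma>. \<sigma> \<in> {0..T} \<Longrightarrow> 0 \<le> C \<sigma>"
    and \<delta>: "\<And>\<sigma>. \<sigma> \<in> {0..T} \<Longrightarrow> 0 < \<delta> \<sigma>"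
    and *: "\<And>\<sigma> \<tau>. \<sigma> \<in> {0..T} \<Longrightarrow> \<tau> \<in> {0..T} \<Longrightarrow> \<bar>\<tau> - \<sigma>\<bar> < \<delta> \<sigma> \<Longrightarrow> sup_bound A T (C \<sigma>) \<tau>"
    by metis
  obtain N where N: "N \<subseteq> {0..T}" "finite N" "{0..T} \<subseteq> (\<Union>c\<in>N. ball c (\<delta> c))"
  proof (rule compactE_image[of "{0..T}" "{0..T}" "\<lambda>c. ball c (\<delta> c)"])
    show "{0..T} \<subseteq> (\<Union>c\<in>{0..T}. ball c (\<delta> c))" using \<delta> by force
  qed auto
  \<comment> \<open>All constants are nonnegative, so their sum over the finite subcover dominates
    each of them.\<close>
  have "sup_bound A T (sum C N) \<tau>" if "\<tau> \<in> {0..T}" for \<tau>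
  proof -
    obtain c where c: "c \<in> N" "\<tau> \<in> ball c (\<delta> c)" using N(3) \<open>\<tau> \<in> {0..T}\<close> by (auto dest!: subsetD)
    then have "sup_bound A T (C c) \<tau>"
      using *[of c \<tau>] N \<open>\<tau> \<in> {0..T}\<close> by (auto simp: dist_real_def abs_minus_commute)
    then show ?thesis
      by (rule sup_bound_mono) (use c N C in \<open>auto intro!: member_le_sum\<close>)
  qed
  moreover have "0 \<le> sum C N" using N C by (auto intro!: sum_nonneg)
  ultimately show ?thesis by blast
qed

text \<open>The same bound on \<open>[0, \<sigma>]\<close> itself. Unlike \<open>sup_bound\<close>,
  this form is preserved by the reflection s -> \<sigma> - s that exchanges a kernel with its
  adjoint.\<close>

definition stable :: "(real \<Rightarrow> 'r::finite cmat) \<Rightarrow> real \<Rightarrow> real \<Rightarrow> bool"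
  where "stable A T C \<longleftrightarrow> (\<forall>\<sigma>\<in>{0..T}. \<forall>F h. continuous_on {0..\<sigma>} F \<longrightarrow> 0 < h \<longrightarrow>
    (\<forall>t\<in>{0..\<sigma>}. norm (F t - conv A \<sigma> F t) \<le> h) \<longrightarrow> (\<forall>t\<in>{0..\<sigma>}. norm (F t) \<le> C * h))"

lemma stable_if_sup_bound:
  assumes A: "continuous_on UNIV A" and b: "\<forall>\<sigma>\<in>{0..T}. sup_bound A T C \<sigma>"
  shows "stable A T C"
  unfolding stable_def
proof (intro ballI allI impI)
  fix \<sigma> F h t
  assume \<sigma>: "\<sigma> \<in> {0..T}" and F: "continuous_on {0..\<sigma>} F" and h: "(0::real) < h"
    and le: "\<forall>t\<in>{0..\<sigma>}. norm (F t - conv A \<sigma> F t) \<le> h" and t: "t \<in> {0..\<sigma>}"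
  \<comment> \<open>Beyond \<sigma> the extension is made so that
    \<open>G - conv A \<sigma> G\<close> keeps its value at \<sigma>: it is continuous and the bound
    \<open>h\<close> persists on \<open>[0, T]\<close>.\<close>
  define G where "G t = (if t \<le> \<sigma> then F t else conv A \<sigma> F t + (F \<sigma> - conv A \<sigma> F \<sigma>))" for t
  have "continuous_on ({0..\<sigma>} \<union> {\<sigma>..T}) G"
    unfolding G_def
    by (intro continuous_on_cases F continuous_intros continuous_on_subset[OF conv_continuous[OF A F]])
       (use \<sigma> in auto)
  moreover have "{0..\<sigma>} \<union> {\<sigma>..T} = {0..T}" using \<sigma> by auto
  ultimately have G: "continuous_on {0..T} G" by simp
  have "conv A \<sigma> G s = conv A \<sigma> F s" for s
    by (rule conv_cong[of _ "{}"]) (auto simp: G_def)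
  then have "norm (G s - conv A \<sigma> G s) \<le> h" if "s \<in> {0..T}" for s
    using that le \<sigma> by (auto simp: G_def)
  with b[rule_format, OF \<sigma>] G h have "norm (G t) \<le> C * h"
    unfolding sup_bound_def using t \<sigma> by auto
  then show "norm (F t) \<le> C * h" using t by (simp add: G_def)
qed

text \<open>The convolution reads \<open>F\<close> only on \<open>[0, \<sigma>]\<close>, where
  \<open>stable\<close> bounds it; beyond \<sigma> the function differs from that convolution by at
  most \<open>h\<close>. This transfers the bound back to the fixed interval for the adjoint kernel
  as well.\<close>

lemma sup_bound_if_stable:
  assumes A: "continuous_on UNIV A" and C: "0 \<le> C" and st: "stable A T C"
  shows "\<exists>D>0. \<forall>\<sigma>\<in>{0..T}. sup_bound A T D \<sigma>"
proof -
  obtain \<kappa> where \<kappa>: "0 \<le> \<kappa>" "\<And>x. x \<in> {-T..T} \<Longrightarrow> norm (herm_kernel A x) \<le> \<kappa>"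
    using herm_kernel_bounded[OF A] by blast
  have "norm (F t) \<le> (1 + \<bar>T\<bar> * (\<kappa> * C)) * h"
    if \<sigma>: "\<sigma> \<in> {0..T}" and F: "continuous_on {0..T} F" and h: "0 < h"
      and le: "\<And>t. t \<in> {0..T} \<Longrightarrow> norm (F t - conv A \<sigma> F t) \<le> h" and t: "t \<in> {0..T}" for \<sigma> F h t
  proof -
    have F\<sigma>: "continuous_on {0..\<sigma>} F" by (rule continuous_on_subset[OF F]) (use \<sigma> in auto)
    have "\<forall>t\<in>{0..\<sigma>}. norm (F t) \<le> C * h"
      by (rule st[unfolded stable_def, rule_format, OF \<sigma> F\<sigma> h, THEN ballI]) (use le \<sigma> in auto)
    then have "norm (conv A \<sigma> F t) \<le> (\<sigma> - 0) * (\<kappa> * (C * h))"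
      unfolding conv_def
      by (intro norm_kernel_integral_le[OF A F\<sigma>, where T = T] \<kappa>) (use \<sigma> t in auto)
    also have "\<dots> \<le> \<bar>T\<bar> * (\<kappa> * (C * h))"
      by (rule mult_right_mono) (use \<sigma> \<kappa>(1) C h in auto)
    finally have "norm (conv A \<sigma> F t) \<le> \<bar>T\<bar> * (\<kappa> * (C * h))" .
    moreover have "norm (F t) \<le> norm (F t - conv A \<sigma> F t) + norm (conv A \<sigma> F t)"
      by (metis diff_add_cancel norm_triangle_ineq)
    ultimately show ?thesis using le[OF t] by (simp add: algebra_simps)
  qed
  then have "\<forall>\<sigma>\<in>{0..T}. sup_bound A T (1 + \<bar>T\<bar> * (\<kappa> * C)) \<sigma>"
    unfolding sup_bound_def by blast
  moreover have "0 < 1 + \<bar>T\<bar> * (\<kappa> * C)"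
    using \<kappa>(1) C by (simp add: add_pos_nonneg)
  ultimately show ?thesis by blast
qed

text \<open>Reflection preserves the supremum norm on \<open>[0, \<sigma>]\<close> and conjugates
  one convolution into the other, so the constant does not change.\<close>

lemma stable_adj:
  assumes "stable A T C"
  shows "stable (adj A) T C"
  unfolding stable_def
proof (intro ballI allI impI)
  fix \<sigma> F h t
  assume \<sigma>: "\<sigma> \<in> {0..T}" and F: "continuous_on {0..\<sigma>} F" and h: "(0::real) < h"
    and le: "\<forall>t\<in>{0..\<sigma>}. norm (F t - conv (adj A) \<sigma> F t) \<le> h" and t: "t \<in> {0..\<sigma>}"
  let ?G = "\<lambda>s. F (\<sigma> - s)"
  have "continuous_on {0..\<sigma>} ?G"
    by (rule continuous_on_compose2[OF F]) (auto intro!: continuous_intros)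
  moreover have "\<forall>s\<in>{0..\<sigma>}. norm (?G s - conv A \<sigma> ?G s) \<le> h"
    using le by (auto simp: conv_reflect)
  ultimately have "norm (?G (\<sigma> - t)) \<le> C * h"
    using assms[unfolded stable_def, rule_format, OF \<sigma>, of ?G h "\<sigma> - t"] h t by auto
  then show "norm (F t) \<le> C * h" by simp
qed

subsection \<open>Evolution of the resolvent columns\<close>

text \<open>The estimate is uniform in the base point. A difference quotient to the left of x is
  therefore one to the right of some y < x, and continuity of \<open>G\<close> replaces
  \<open>G y\<close> by \<open>G x\<close>.\<close>

lemma has_vector_derivative_if_one_sided:
  fixes F :: "real \<Rightarrow> 'a::real_normed_vector"
  assumes G: "continuous_on {a..b} G"
    and F: "\<And>\<epsilon>. 0 < \<epsilon> \<Longrightarrow> \<exists>\<delta>>0. \<forall>\<sigma> \<tau>. a \<le> \<sigma> \<longrightarrow> \<sigma> < \<tau> \<longrightarrow> \<tau> \<le> b \<longrightarrow> \<tau> - \<sigma> < \<delta> \<longrightarrow>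
          norm (F \<tau> - F \<sigma> - (\<tau> - \<sigma>) *\<^sub>R G \<sigma>) \<le> \<epsilon> * (\<tau> - \<sigma>)"
    and x: "x \<in> {a..b}"
  shows "(F has_vector_derivative G x) (at x within {a..b})"
  unfolding has_vector_derivative_def has_derivative_within_alt
proof (intro conjI allI impI)
  show "bounded_linear (\<lambda>h. h *\<^sub>R G x)" by (rule bounded_linear_scaleR_left)
  fix e :: real assume e: "0 < e"
  obtain \<delta> where \<delta>: "0 < \<delta>" "\<And>\<sigma> \<tau>. a \<le> \<sigma> \<Longrightarrow> \<sigma> < \<tau> \<Longrightarrow> \<tau> \<le> b \<Longrightarrow> \<tau> - \<sigma> < \<delta> \<Longrightarrow>
      norm (F \<tau> - F \<sigma> - (\<tau> - \<sigma>) *\<^sub>R G \<sigma>) \<le> e / 2 * (\<tau> - \<sigma>)"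
    using F[of "e / 2"] e by auto
  obtain \<eta> where \<eta>: "0 < \<eta>" "\<And>y. y \<in> {a..b} \<Longrightarrow> dist y x < \<eta> \<Longrightarrow> dist (G y) (G x) < e / 2"
    using G[unfolded continuous_on_iff, rule_format, OF x, of "e / 2"] e by auto
  have "norm (F y - F x - (y - x) *\<^sub>R G x) \<le> e * norm (y - x)"
    if y: "y \<in> {a..b}" "norm (y - x) < min \<delta> \<eta>" for y
  proof -
    consider "x < y" | "y = x" | "y < x" by linarith
    then show ?thesis
    proof cases
      case 1
      then have "norm (F y - F x - (y - x) *\<^sub>R G x) \<le> e / 2 * (y - x)"
        using \<delta>(2)[of x y] x y by auto
      also have "\<dots> \<le> e * (y - x)" using 1 e by (intro mult_right_mono) auto
      finally show ?thesis using 1 by simp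
    next
      case 3
      have "F y - F x - (y - x) *\<^sub>R G x = - (F x - F y - (x - y) *\<^sub>R G y) - (x - y) *\<^sub>R (G y - G x)"
        by (simp add: algebra_simps)
      then have "norm (F y - F x - (y - x) *\<^sub>R G x)
          \<le> norm (F x - F y - (x - y) *\<^sub>R G y) + norm ((x - y) *\<^sub>R (G y - G x))"
        using norm_triangle_ineq4[of "- (F x - F y - (x - y) *\<^sub>R G y)" "(x - y) *\<^sub>R (G y - G x)"]
        by (simp only: norm_minus_cancel)
      moreover have "norm (F x - F y - (x - y) *\<^sub>R G y) \<le> e / 2 * (x - y)"
        using \<delta>(2)[of y x] x y 3 by auto
      moreover have "norm ((x - y) *\<^sub>R (G y - G x)) \<le> e / 2 * (x - y)"
        using \<eta>(2)[of y] x y 3 by (auto simp: dist_norm)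
      ultimately have "norm (F y - F x - (y - x) *\<^sub>R G x) \<le> e / 2 * (x - y) + e / 2 * (x - y)"
        by linarith
      then show ?thesis using 3 by simp
    qed simp
  qed
  then show "\<exists>d>0. \<forall>y\<in>{a..b}. norm (y - x) < d \<longrightarrow> norm (F y - F x - (y - x) *\<^sub>R G x) \<le> e * norm (y - x)"
    using \<delta>(1) \<eta>(1) by (metis min_less_iff_conj)
qed

lemma continuous_on_Times_if_Lipschitz:
  fixes P :: "'a::metric_space \<Rightarrow> 'b::metric_space \<Rightarrow> 'c::metric_space"
  assumes cont: "\<And>\<tau>. \<tau> \<in> S \<Longrightarrow> continuous_on S' (P \<tau>)"
    and lip: "\<And>\<tau> \<sigma> t. \<tau> \<in> S \<Longrightarrow> \<sigma> \<in> S \<Longrightarrow> t \<in> S' \<Longrightarrow> dist (P \<tau> t) (P \<sigma> t) \<le> L * dist \<tau> \<sigma>" and L: "0 \<le> L"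
  shows "continuous_on (S \<times> S') (\<lambda>(\<tau>, t). P \<tau> t)"
  unfolding continuous_on_iff
proof (intro ballI allI impI)
  fix p :: "'a \<times> 'b" and e :: real
  assume "p \<in> S \<times> S'" "0 < e"
  then obtain \<tau>0 t0 where p: "p = (\<tau>0, t0)" and 0: "\<tau>0 \<in> S" "t0 \<in> S'" "0 < e" by auto
  obtain d where d: "0 < d" "\<And>t. t \<in> S' \<Longrightarrow> dist t t0 < d \<Longrightarrow> dist (P \<tau>0 t) (P \<tau>0 t0) < e / 2"
    using cont[OF 0(1), unfolded continuous_on_iff, rule_format, OF 0(2), of "e / 2"] 0 by auto
  have "dist (P \<tau> t) (P \<tau>0 t0) < e"
    if "\<tau> \<in> S" "t \<in> S'" "dist (\<tau>, t) (\<tau>0, t0) < min d (e / (2 * (L + 1)))" for \<tau> t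
  proof -
    have *: "dist \<tau> \<tau>0 \<le> dist (\<tau>, t) (\<tau>0, t0)" "dist t t0 \<le> dist (\<tau>, t) (\<tau>0, t0)"
      using dist_fst_le[of "(\<tau>, t)" "(\<tau>0, t0)"] dist_snd_le[of "(\<tau>, t)" "(\<tau>0, t0)"] by auto
    have "L * dist \<tau> \<tau>0 \<le> (L + 1) * dist \<tau> \<tau>0" by (simp add: algebra_simps)
    also have "\<dots> \<le> (L + 1) * (e / (2 * (L + 1)))"
      using that * L by (intro mult_left_mono) auto
    also have "\<dots> = e / 2" using L by (simp add: divide_simps)
    finally have "dist (P \<tau> t) (P \<tau>0 t) \<le> e / 2" using lip[OF that(1) 0(1) that(2)] by linarith
    moreover have "dist (P \<tau>0 t) (P \<tau>0 t0) < e / 2" using d(2)[OF that(2)] that(3) * by auto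
    ultimately show ?thesis using dist_triangle[of "P \<tau> t" "P \<tau>0 t0" "P \<tau>0 t"] by linarith
  qed
  moreover have "0 < min d (e / (2 * (L + 1)))" using d(1) 0 L by simp
  ultimately show "\<exists>d>0. \<forall>x'\<in>S \<times> S'. dist x' p < d \<longrightarrow>
      dist (case x' of (\<tau>, t) \<Rightarrow> P \<tau> t) (case p of (\<tau>, t) \<Rightarrow> P \<tau> t) < e"
    unfolding p
    by (intro exI[of _ "min d (e / (2 * (L + 1)))"]) auto
qed

lemma conv_diff:
  assumes A: "continuous_on UNIV A" and F: "continuous_on {0..\<sigma>} F" and G: "continuous_on {0..\<sigma>} G" and t: "0 \<le> t"
  shows "conv A \<sigma> (\<lambda>s. F s - G s) t = conv A \<sigma> F t - conv A \<sigma> G t"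
  unfolding conv_def mmult.diff_right
  by (intro Henstock_Kurzweil_Integration.integral_diff conv_split(1)[OF A _ t] F G)

text \<open>The kernel acts from the left, hence commutes with right multiplication by a constant
  matrix. This is why a solution times a constant matrix can serve as the derivative in Krein's
  formulas.\<close>

lemma conv_mult_scaleR:
  assumes A: "continuous_on UNIV A" and F: "continuous_on {0..\<sigma>} F" and t: "0 \<le> t"
  shows "conv A \<sigma> (\<lambda>s. c *\<^sub>R (F s ** X)) t = c *\<^sub>R (conv A \<sigma> F t ** X)"
  unfolding conv_def mmult.scaleR_right
  using integral_mmult_left[OF conv_split(1)[OF A F t], of X] by (simp add: matrix_mul_assoc)

text \<open>The equation is imposed for all \<open>t\<close> in \<open>[0, T]\<close>, also beyond
  \<tau>, so that \<open>P \<tau>\<close> and \<open>P \<sigma>\<close> can be subtracted on a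
  common interval. The locale is instantiated with a kernel and with its adjoint.\<close>

locale krein_family =
  fixes A :: "real \<Rightarrow> 'r::finite cmat" and T C :: real and P :: "real \<Rightarrow> real \<Rightarrow> 'r cmat"
  assumes A_cont: "continuous_on UNIV A" and C_nonneg: "0 \<le> C" and stable: "stable A T C"
    and P_cont: "\<And>\<tau>. \<tau> \<in> {0..T} \<Longrightarrow> continuous_on {0..T} (P \<tau>)"
    and P_eq: "\<And>\<tau> t. \<tau> \<in> {0..T} \<Longrightarrow> t \<in> {0..T} \<Longrightarrow> P \<tau> t = A t + conv A \<tau> (P \<tau>) t"
begin

text \<open>Subtracting the equations for \<sigma> < \<tau> shows that
  \<open>P \<tau> - P \<sigma>\<close> solves the equation of length \<sigma> with an integral over
  \<open>[\<sigma>, \<tau>]\<close> as right side, which is of order \<tau> - \<sigma>.\<close>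

lemma P_Lipschitz:
  "\<exists>L\<ge>0. \<forall>\<tau>\<in>{0..T}. \<forall>\<sigma>\<in>{0..T}. \<forall>t\<in>{0..T}. dist (P \<tau> t) (P \<sigma> t) \<le> L * dist \<tau> \<sigma>"
proof -
  obtain \<kappa> where \<kappa>: "0 \<le> \<kappa>" "\<And>x. x \<in> {-T..T} \<Longrightarrow> norm (herm_kernel A x) \<le> \<kappa>"
    using herm_kernel_bounded[OF A_cont] by blast
  obtain D where D: "0 < D" "\<And>\<sigma>. \<sigma> \<in> {0..T} \<Longrightarrow> sup_bound A T D \<sigma>"
    using sup_bound_if_stable[OF A_cont C_nonneg stable] by blast
  note bound = D(2)[unfolded sup_bound_def, rule_format]
  have M: "norm (P \<tau> t) \<le> D * (\<kappa> + 1)" if "\<tau> \<in> {0..T}" "t \<in> {0..T}" for \<tau> t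
  proof (rule bound[OF that(1) P_cont[OF that(1)] _ _ that(2)])
    show "norm (P \<tau> s - conv A \<tau> (P \<tau>) s) \<le> \<kappa> + 1" if "s \<in> {0..T}" for s
      using P_eq[OF \<open>\<tau> \<in> {0..T}\<close> that] \<kappa>(2)[of s] that by (auto simp: herm_kernel_def)
  qed (use \<kappa> in auto)
  \<comment> \<open>\<open>D * (\<kappa> + 1)\<close> bounds all \<open>P\<close>, the factor
    \<kappa> bounds the kernel, and the outer \<open>D\<close> is the bound for solutions. Both
    summands 1 keep the quantity \<open>h\<close> of \<open>sup_bound\<close> strictly
    positive.\<close>
  define L where "L = D * (\<kappa> * (D * (\<kappa> + 1)) + 1)"
  have less: "dist (P \<tau> t) (P \<sigma> t) \<le> L * dist \<tau> \<sigma>"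
    if st: "\<sigma> \<in> {0..T}" "\<tau> \<in> {0..T}" "\<sigma> < \<tau>" "t \<in> {0..T}" for \<sigma> \<tau> t
  proof -
    let ?h = "(\<tau> - \<sigma>) * (\<kappa> * (D * (\<kappa> + 1)) + 1)"
    have c: "continuous_on {0..\<rho>} (P \<tau>)" "continuous_on {0..\<rho>} (P \<sigma>)" if "\<rho> \<le> T" for \<rho>
      by (rule continuous_on_subset[OF P_cont], use st that in auto)+
    have "norm (P \<tau> t - P \<sigma> t) \<le> D * ?h"
    proof (rule bound[OF st(1) _ _ _ st(4)])
      show "continuous_on {0..T} (\<lambda>t. P \<tau> t - P \<sigma> t)"
        by (intro continuous_on_diff c) auto
      show "0 < ?h" using st \<kappa>(1) D(1) by (simp add: add_nonneg_pos)
      show "norm (P \<tau> s - P \<sigma> s - conv A \<sigma> (\<lambda>t. P \<tau> t - P \<sigma> t) s) \<le> ?h" if s: "s \<in> {0..T}" for s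
      proof -
        have "P \<tau> s - P \<sigma> s - conv A \<sigma> (\<lambda>t. P \<tau> t - P \<sigma> t) s = integral {\<sigma>..\<tau>} (\<lambda>\<xi>. herm_kernel A (s - \<xi>) ** P \<tau> \<xi>)"
          using conv_combine[OF A_cont c(1), of \<tau> \<sigma> s] conv_diff[OF A_cont c, of \<sigma> s] P_eq[of \<tau> s] P_eq[of \<sigma> s] st s
          by (simp add: algebra_simps)
        also have "norm \<dots> \<le> (\<tau> - \<sigma>) * (\<kappa> * (D * (\<kappa> + 1)))"
          by (rule norm_kernel_integral_le[OF A_cont c(1) _ _ _ s \<kappa> M]) (use st in auto)
        also have "\<dots> \<le> ?h" using st by (intro mult_left_mono) auto
        finally show ?thesis .
      qed
    qed
    then show ?thesis using st by (simp add: L_def dist_norm algebra_simps)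
  qed
  have "dist (P \<tau> t) (P \<sigma> t) \<le> L * dist \<tau> \<sigma>" if "\<sigma> \<in> {0..T}" "\<tau> \<in> {0..T}" "t \<in> {0..T}" for \<sigma> \<tau> t
    using less[of \<sigma> \<tau> t] less[of \<tau> \<sigma> t] that
    by (cases \<sigma> \<tau> rule: linorder_cases) (auto simp: dist_commute)
  moreover have "0 \<le> L" using D(1) \<kappa>(1) by (simp add: L_def)
  ultimately show ?thesis by blast
qed

lemma P_jointly_continuous: "continuous_on ({0..T} \<times> {0..T}) (\<lambda>(\<tau>, t). P \<tau> t)"
proof -
  obtain L where "0 \<le> L" "\<forall>\<tau>\<in>{0..T}. \<forall>\<sigma>\<in>{0..T}. \<forall>t\<in>{0..T}. dist (P \<tau> t) (P \<sigma> t) \<le> L * dist \<tau> \<sigma>"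
    using P_Lipschitz by blast
  then show ?thesis
    by (intro continuous_on_Times_if_Lipschitz[where L = L] P_cont) auto
qed

lemma P_continuous_compose:
  assumes "continuous_on S f" "continuous_on S g" "f ` S \<subseteq> {0..T}" "g ` S \<subseteq> {0..T}"
  shows "continuous_on S (\<lambda>x. P (f x) (g x))"
proof -
  have "continuous_on S (\<lambda>x. case (f x, g x) of (\<tau>, t) \<Rightarrow> P \<tau> t)"
    by (rule continuous_on_compose2[OF P_jointly_continuous])
       (use assms in \<open>auto intro!: continuous_on_Pair\<close>)
  then show ?thesis by simp
qed

end

locale krein_pair = P: krein_family A T C P + Q: krein_family "adj A" T C Q
  for A :: "real \<Rightarrow> 'r::finite cmat" and T C P Q
begin

text \<open>
  The kernel jumps on the diagonal, so the estimate is restricted to \<open>t \<le> \<sigma> < \<tau>\<close>, where only its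
  values on one side of the jump enter. Being uniform, it still controls the derivative from the left.
\<close>

lemma P_one_sided:
  assumes \<epsilon>: "0 < \<epsilon>"
  shows "\<exists>\<delta>>0. \<forall>\<sigma> \<tau> t. 0 \<le> t \<longrightarrow> t \<le> \<sigma> \<longrightarrow> \<sigma> < \<tau> \<longrightarrow> \<tau> \<le> T \<longrightarrow> \<tau> - \<sigma> < \<delta> \<longrightarrow>
    norm (P \<tau> t - P \<sigma> t - (\<tau> - \<sigma>) *\<^sub>R (Q \<sigma> (\<sigma> - t) ** P \<sigma> \<sigma>)) \<le> \<epsilon> * (\<tau> - \<sigma>)"
proof -
  \<comment> \<open>For s \<ge> t this is the integrand of the convolution with the value 0- of the
    jump on the diagonal, hence jointly continuous.\<close>
  define H where "H = (\<lambda>(t, \<tau>, s). ctranspose (A (s - t)) ** P \<tau> s)"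
  define e where "e = \<epsilon> / (C + 1)"
  have e: "0 < e" "C * e \<le> \<epsilon>"
    using \<epsilon> P.C_nonneg by (auto simp: e_def field_simps)
  have "continuous_on ({0..T} \<times> {0..T} \<times> {0..T}) H"
    unfolding H_def split_def
    by (intro mmult.continuous_on continuous_on_ctranspose P.P_continuous_compose
         continuous_on_compose2[OF P.A_cont] continuous_intros) auto
  then have "uniformly_continuous_on ({0..T} \<times> {0..T} \<times> {0..T}) H"
    by (intro compact_uniformly_continuous compact_Times) auto
  then obtain \<eta> where \<eta>: "0 < \<eta>" "\<And>x y. x \<in> {0..T} \<times> {0..T} \<times> {0..T} \<Longrightarrow> y \<in> {0..T} \<times> {0..T} \<times> {0..T} \<Longrightarrow>
      dist y x < \<eta> \<Longrightarrow> dist (H y) (H x) < e"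
    unfolding uniformly_continuous_on_def using e by metis
  have "norm (P \<tau> t - P \<sigma> t - (\<tau> - \<sigma>) *\<^sub>R (Q \<sigma> (\<sigma> - t) ** P \<sigma> \<sigma>)) \<le> \<epsilon> * (\<tau> - \<sigma>)"
    if st: "0 \<le> t" "t \<le> \<sigma>" "\<sigma> < \<tau>" "\<tau> \<le> T" "\<tau> - \<sigma> < \<eta> / 2" for \<sigma> \<tau> t
  proof -
    have mem: "\<sigma> \<in> {0..T}" "\<tau> \<in> {0..T}" using st by auto
    have c: "continuous_on {0..\<rho>} (P \<tau>)" "continuous_on {0..\<rho>} (P \<sigma>)" if "\<rho> \<le> T" for \<rho>
      by (rule continuous_on_subset[OF P.P_cont], use mem that in auto)+
    let ?E = "\<lambda>t. Q \<sigma> (\<sigma> - t)" and ?X = "P \<sigma> \<sigma>"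
    have cE: "continuous_on {0..\<sigma>} ?E"
      by (rule continuous_on_compose2[OF Q.P_cont]) (use mem in \<open>auto intro!: continuous_intros\<close>)
    let ?D = "\<lambda>t. P \<tau> t - P \<sigma> t - (\<tau> - \<sigma>) *\<^sub>R (?E t ** ?X)"
    have H: "norm (?D s - conv A \<sigma> ?D s) \<le> (\<tau> - \<sigma>) * e" if s: "s \<in> {0..\<sigma>}" for s
    proof -
      have s': "s \<in> {0..T}" "0 \<le> s" using s mem by auto
      have cEX: "continuous_on {0..\<sigma>} (\<lambda>s. (\<tau> - \<sigma>) *\<^sub>R (?E s ** ?X))"
        by (intro continuous_intros mmult.continuous_on cE)
      \<comment> \<open>The reflected \<open>Q \<sigma>\<close> solves the equation whose right side
        is the kernel at s - \<sigma>. Multiplied by \<open>P \<sigma> \<sigma>\<close>, this right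
        side is the leading term of the integral over \<open>[\<sigma>, \<tau>]\<close>.\<close>
      have E: "?E s - conv A \<sigma> ?E s = ctranspose (A (\<sigma> - s))"
        using Q.P_eq[of \<sigma> "\<sigma> - s"] mem s by (auto simp: conv_reflect)
      have I: "(\<lambda>\<xi>. herm_kernel A (s - \<xi>) ** P \<tau> \<xi>) integrable_on {\<sigma>..\<tau>}"
        by (rule integrable_on_subinterval[OF conv_split(1)[OF P.A_cont c(1)[of \<tau>]]]) (use mem s in auto)
      have "conv A \<sigma> ?D s = conv A \<sigma> (P \<tau>) s - conv A \<sigma> (P \<sigma>) s - (\<tau> - \<sigma>) *\<^sub>R (conv A \<sigma> ?E s ** ?X)"
        using mem s' conv_diff[OF P.A_cont continuous_on_diff[OF c] cEX, of s]
          conv_diff[OF P.A_cont c, of \<sigma> s] conv_mult_scaleR[OF P.A_cont cE, of s "\<tau> - \<sigma>" ?X]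
        by simp
      then have "?D s - conv A \<sigma> ?D s = (P \<tau> s - conv A \<sigma> (P \<tau>) s) - (P \<sigma> s - conv A \<sigma> (P \<sigma>) s)
          - (\<tau> - \<sigma>) *\<^sub>R ((?E s - conv A \<sigma> ?E s) ** ?X)"
        by (simp add: mmult.diff_left algebra_simps)
      also have "P \<sigma> s - conv A \<sigma> (P \<sigma>) s = A s"
        using P.P_eq[OF mem(1) s'(1)] by simp
      also have "P \<tau> s - conv A \<sigma> (P \<tau>) s = A s + integral {\<sigma>..\<tau>} (\<lambda>\<xi>. herm_kernel A (s - \<xi>) ** P \<tau> \<xi>)"
        using P.P_eq[OF mem(2) s'(1)] conv_combine[OF P.A_cont c(1)[of \<tau>], of \<sigma> s] mem st s by simp
      also have "?E s - conv A \<sigma> ?E s = ctranspose (A (\<sigma> - s))" by (rule E)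
      also have "A s + integral {\<sigma>..\<tau>} (\<lambda>\<xi>. herm_kernel A (s - \<xi>) ** P \<tau> \<xi>) - A s - (\<tau> - \<sigma>) *\<^sub>R (ctranspose (A (\<sigma> - s)) ** ?X)
          = integral {\<sigma>..\<tau>} (\<lambda>\<xi>. herm_kernel A (s - \<xi>) ** P \<tau> \<xi>) - integral {\<sigma>..\<tau>} (\<lambda>\<xi>. H (s, \<sigma>, \<sigma>))"
        using st by (simp add: H_def)
      also have "\<dots> = integral {\<sigma>..\<tau>} (\<lambda>\<xi>. herm_kernel A (s - \<xi>) ** P \<tau> \<xi> - H (s, \<sigma>, \<sigma>))"
        by (intro Henstock_Kurzweil_Integration.integral_diff[symmetric] I) auto
      \<comment> \<open>Here \<xi> \<ge> \<sigma> \<ge> s, so only the adjoint branch of the kernel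
        occurs; the exceptional point \<xi> = s lies in the interval only for s = \<sigma>.\<close>
      also have "\<dots> = integral {\<sigma>..\<tau>} (\<lambda>\<xi>. H (s, \<tau>, \<xi>) - H (s, \<sigma>, \<sigma>))"
        by (rule integral_spike[of "{s}"]) (use s in \<open>auto simp: H_def herm_kernel_def\<close>)
      also have "norm \<dots> \<le> (\<tau> - \<sigma>) * e"
      proof (rule norm_integral_le_const)
        show "(\<lambda>\<xi>. H (s, \<tau>, \<xi>) - H (s, \<sigma>, \<sigma>)) integrable_on {\<sigma>..\<tau>}"
          unfolding H_def split
          by (intro integrable_continuous_interval continuous_intros mmult.continuous_on continuous_on_ctranspose
               continuous_on_compose2[OF P.A_cont] continuous_on_subset[OF P.P_cont]) (use mem in auto)
        show "norm (H (s, \<tau>, \<xi>) - H (s, \<sigma>, \<sigma>)) \<le> e" if \<xi>: "\<xi> \<in> {\<sigma>..\<tau>}" for \<xi>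
        proof -
          have "dist (s, \<tau>, \<xi>) (s, \<sigma>, \<sigma>) \<le> dist \<tau> \<sigma> + dist \<xi> \<sigma>"
            by (simp add: dist_Pair_Pair sqrt_sum_squares_le_sum)
          also have "\<dots> < \<eta>" using \<xi> st by (auto simp: dist_real_def)
          finally show ?thesis
            using \<eta>(2)[of "(s, \<sigma>, \<sigma>)" "(s, \<tau>, \<xi>)"] mem s' \<xi> by (auto simp: dist_norm)
        qed
      qed (use st in auto)
      finally show ?thesis .
    qed
    have "norm (?D t) \<le> C * ((\<tau> - \<sigma>) * e)"
    proof (rule P.stable[unfolded stable_def, rule_format, OF mem(1), where F = ?D])
      show "continuous_on {0..\<sigma>} ?D"
        by (intro continuous_intros c mmult.continuous_on cE) (use mem in auto)
    qed (use H st e in auto)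
    also have "\<dots> \<le> \<epsilon> * (\<tau> - \<sigma>)"
      using mult_right_mono[OF e(2), of "\<tau> - \<sigma>"] st by (simp add: algebra_simps)
    finally show ?thesis .
  qed
  then show ?thesis using \<eta>(1) by (intro exI[of _ "\<eta> / 2"]) auto
qed

text \<open>The range is \<tau> \<ge> t because the derivative evaluates \<open>Q \<tau>\<close> at
  \<tau> - t.\<close>

lemma P_has_derivative:
  assumes t: "0 \<le> t" and \<tau>: "\<tau> \<in> {t..T}"
  shows "((\<lambda>\<tau>. P \<tau> t) has_vector_derivative (Q \<tau> (\<tau> - t) ** P \<tau> \<tau>)) (at \<tau> within {t..T})"
proof (rule has_vector_derivative_if_one_sided[OF _ _ \<tau>])
  show "continuous_on {t..T} (\<lambda>\<tau>. Q \<tau> (\<tau> - t) ** P \<tau> \<tau>)"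
    by (intro mmult.continuous_on P.P_continuous_compose Q.P_continuous_compose continuous_intros) (use t in auto)
  show "\<exists>\<delta>>0. \<forall>\<sigma> \<tau>. t \<le> \<sigma> \<longrightarrow> \<sigma> < \<tau> \<longrightarrow> \<tau> \<le> T \<longrightarrow> \<tau> - \<sigma> < \<delta> \<longrightarrow>
      norm (P \<tau> t - P \<sigma> t - (\<tau> - \<sigma>) *\<^sub>R (Q \<sigma> (\<sigma> - t) ** P \<sigma> \<sigma>)) \<le> \<epsilon> * (\<tau> - \<sigma>)" if "0 < \<epsilon>" for \<epsilon>
    using P_one_sided[OF that] t by meson
qed

text \<open>Taking adjoints twice gives back the kernel, so P and Q may exchange roles. This turns
  the derivative of P into the one of Q.\<close>

lemma krein_pair_adj: "krein_pair (adj A) T C Q P"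
  by (intro krein_pair.intro) (simp_all add: P.krein_family_axioms Q.krein_family_axioms)

end

subsection \<open>Differentiation of an integral over a triangle\<close>

text \<open>The data exist only for s \<le> \<tau>. Comparing \<sigma> < \<tau> one-sidedly, both
  integrands are defined on \<open>[0, \<sigma>]\<close>, while the strip
  \<open>[\<sigma>, \<tau>]\<close> produces the boundary term.\<close>

lemma leibniz_triangle:
  fixes \<Phi> \<Psi> :: "real \<Rightarrow> real \<Rightarrow> 'a::euclidean_space"
  assumes \<Phi>: "continuous_on {(\<tau>, s). 0 \<le> s \<and> s \<le> \<tau> \<and> \<tau> \<le> T} (\<lambda>(\<tau>, s). \<Phi> \<tau> s)"
    and \<Psi>: "continuous_on {(\<tau>, s). 0 \<le> s \<and> s \<le> \<tau> \<and> \<tau> \<le> T} (\<lambda>(\<tau>, s). \<Psi> \<tau> s)"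
    and der: "\<And>s \<tau>. 0 \<le> s \<Longrightarrow> s \<le> \<tau> \<Longrightarrow> \<tau> \<le> T \<Longrightarrow> ((\<lambda>\<tau>. \<Phi> \<tau> s) has_vector_derivative \<Psi> \<tau> s) (at \<tau> within {s..T})"
    and x: "x \<in> {0..T}"
  shows "((\<lambda>\<tau>. integral {0..\<tau>} (\<Phi> \<tau>)) has_vector_derivative (\<Phi> x x + integral {0..x} (\<Psi> x))) (at x within {0..T})"
proof (rule has_vector_derivative_if_one_sided[OF _ _ x])
  let ?D = "{(\<tau>, s). 0 \<le> s \<and> s \<le> \<tau> \<and> \<tau> \<le> T}"
  have comp: "continuous_on S (\<lambda>x. \<Theta> (f x) (g x))"
    if "continuous_on ?D (\<lambda>(\<tau>, s). \<Theta> \<tau> s)" "continuous_on S f" "continuous_on S g" "\<And>x. x \<in> S \<Longrightarrow> 0 \<le> g x \<and> g x \<le> f x \<and> f x \<le> T"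
    for \<Theta> :: "real \<Rightarrow> real \<Rightarrow> 'a" and S :: "'c::topological_space set" and f g
  proof -
    have "continuous_on S (\<lambda>x. case (f x, g x) of (\<tau>, t) \<Rightarrow> \<Theta> \<tau> t)"
      by (rule continuous_on_compose2[OF that(1)]) (use that in \<open>auto intro!: continuous_on_Pair\<close>)
    then show ?thesis by simp
  qed
  have cs: "continuous_on {0..\<tau>} (\<Phi> \<tau>)" "continuous_on {0..\<tau>} (\<Psi> \<tau>)" if "\<tau> \<le> T" for \<tau>
    using that by (auto intro!: comp[OF \<Phi>] comp[OF \<Psi>] continuous_intros)
  show "continuous_on {0..T} (\<lambda>\<tau>. \<Phi> \<tau> \<tau> + integral {0..\<tau>} (\<Psi> \<tau>))"
  proof (intro continuous_on_add comp[OF \<Phi>] continuous_on_id)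
    \<comment> \<open>The minimum continues \<Psi> beyond the diagonal by its diagonal value, which
      gives an integral over a fixed interval; the added piece is explicit and is subtracted
      again.\<close>
    have "continuous_on {0..T} (\<lambda>\<tau>. integral (cbox 0 T) (\<lambda>s. \<Psi> \<tau> (min s \<tau>)))"
      by (rule integral_continuous_on_param)
         (auto simp: split_def intro!: comp[OF \<Psi>] continuous_intros)
    then have "continuous_on {0..T} (\<lambda>\<tau>. integral {0..T} (\<lambda>s. \<Psi> \<tau> (min s \<tau>)) - (T - \<tau>) *\<^sub>R \<Psi> \<tau> \<tau>)"
      by (intro continuous_intros comp[OF \<Psi>]) auto
    moreover have "integral {0..T} (\<lambda>s. \<Psi> \<tau> (min s \<tau>)) - (T - \<tau>) *\<^sub>R \<Psi> \<tau> \<tau> = integral {0..\<tau>} (\<Psi> \<tau>)"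
      if \<tau>: "\<tau> \<in> {0..T}" for \<tau>
    proof -
      have "integral {0..\<tau>} (\<lambda>s. \<Psi> \<tau> (min s \<tau>)) + integral {\<tau>..T} (\<lambda>s. \<Psi> \<tau> (min s \<tau>)) = integral {0..T} (\<lambda>s. \<Psi> \<tau> (min s \<tau>))"
        by (rule Henstock_Kurzweil_Integration.integral_combine)
           (use \<tau> in \<open>auto intro!: integrable_continuous_interval comp[OF \<Psi>] continuous_intros\<close>)
      moreover have "integral {0..\<tau>} (\<lambda>s. \<Psi> \<tau> (min s \<tau>)) = integral {0..\<tau>} (\<Psi> \<tau>)"
        by (rule integral_cong) auto
      moreover have "integral {\<tau>..T} (\<lambda>s. \<Psi> \<tau> (min s \<tau>)) = integral {\<tau>..T} (\<lambda>s. \<Psi> \<tau> \<tau>)"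
        by (rule integral_cong) auto
      ultimately show ?thesis using \<tau> by (simp add: algebra_simps)
    qed
    ultimately show "continuous_on {0..T} (\<lambda>\<tau>. integral {0..\<tau>} (\<Psi> \<tau>))"
      by (rule continuous_on_eq)
  qed auto
  fix \<epsilon> :: real assume \<epsilon>: "0 < \<epsilon>"
  \<comment> \<open>The strip costs e (\<tau> - \<sigma>) and the integral over
    \<open>[0, \<sigma>]\<close> at most |T| e (\<tau> - \<sigma>).\<close>
  define e where "e = \<epsilon> / (1 + \<bar>T\<bar>)"
  have e: "0 < e" using \<epsilon> by (simp add: e_def add_pos_nonneg)
  have ce: "(1 + \<bar>T\<bar>) * e = \<epsilon>" by (simp add: e_def field_simps)
  have D: "compact ?D"
  proof -
    have "compact (({0..T} \<times> {0..T}) \<inter> {p. snd p \<le> fst p})"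
      by (intro compact_Int_closed compact_Times closed_Collect_le continuous_intros) auto
    moreover have "({0..T} \<times> {0..T}) \<inter> {p. snd p \<le> fst p} = ?D" by auto
    ultimately show ?thesis by simp
  qed
  have uc: "\<exists>\<eta>>0. \<forall>\<tau> s \<tau>' s'. 0 \<le> s \<and> s \<le> \<tau> \<and> \<tau> \<le> T \<and> 0 \<le> s' \<and> s' \<le> \<tau>' \<and> \<tau>' \<le> T \<and> \<bar>\<tau> - \<tau>'\<bar> < \<eta> \<and> \<bar>s - s'\<bar> < \<eta> \<longrightarrow>
      norm (\<Theta> \<tau> s - \<Theta> \<tau>' s') \<le> e"
    if \<Theta>: "continuous_on ?D (\<lambda>(\<tau>, s). \<Theta> \<tau> s)" for \<Theta> :: "real \<Rightarrow> real \<Rightarrow> 'a"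
  proof -
    obtain \<eta> where \<eta>: "0 < \<eta>" "\<forall>p\<in>?D. \<forall>q\<in>?D. dist q p < \<eta> \<longrightarrow>
       dist ((\<lambda>(\<tau>, s). \<Theta> \<tau> s) q) ((\<lambda>(\<tau>, s). \<Theta> \<tau> s) p) < e"
      using compact_uniformly_continuous[OF \<Theta> D, unfolded uniformly_continuous_on_def, THEN spec, THEN mp, OF e]
      by blast
    have "norm (\<Theta> \<tau> s - \<Theta> \<tau>' s') \<le> e"
      if "0 \<le> s" "s \<le> \<tau>" "\<tau> \<le> T" "0 \<le> s'" "s' \<le> \<tau>'" "\<tau>' \<le> T" "\<bar>\<tau> - \<tau>'\<bar> < \<eta> / 2" "\<bar>s - s'\<bar> < \<eta> / 2" for \<tau> s \<tau>' s'
    proof -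
      have "dist (\<tau>, s) (\<tau>', s') \<le> dist \<tau> \<tau>' + dist s s'"
        by (simp add: dist_Pair_Pair sqrt_sum_squares_le_sum)
      also have "\<dots> < \<eta>" using that by (auto simp: dist_real_def)
      finally show ?thesis using \<eta>(2)[THEN bspec, of "(\<tau>', s')", THEN bspec, of "(\<tau>, s)"] that by (auto simp: dist_norm)
    qed
    then show ?thesis using \<eta>(1) by (intro exI[of _ "\<eta> / 2"]) auto
  qed
  obtain \<eta>1 where \<eta>1: "0 < \<eta>1" "\<And>\<tau> s \<tau>' s'. 0 \<le> s \<Longrightarrow> s \<le> \<tau> \<Longrightarrow> \<tau> \<le> T \<Longrightarrow> 0 \<le> s' \<Longrightarrow> s' \<le> \<tau>' \<Longrightarrow> \<tau>' \<le> T \<Longrightarrow>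
      \<bar>\<tau> - \<tau>'\<bar> < \<eta>1 \<Longrightarrow> \<bar>s - s'\<bar> < \<eta>1 \<Longrightarrow> norm (\<Phi> \<tau> s - \<Phi> \<tau>' s') \<le> e"
    using uc[OF \<Phi>] by blast
  obtain \<eta>2 where \<eta>2: "0 < \<eta>2" "\<And>\<tau> s \<tau>' s'. 0 \<le> s \<Longrightarrow> s \<le> \<tau> \<Longrightarrow> \<tau> \<le> T \<Longrightarrow> 0 \<le> s' \<Longrightarrow> s' \<le> \<tau>' \<Longrightarrow> \<tau>' \<le> T \<Longrightarrow>
      \<bar>\<tau> - \<tau>'\<bar> < \<eta>2 \<Longrightarrow> \<bar>s - s'\<bar> < \<eta>2 \<Longrightarrow> norm (\<Psi> \<tau> s - \<Psi> \<tau>' s') \<le> e"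
    using uc[OF \<Psi>] by blast
  have "norm (integral {0..\<tau>} (\<Phi> \<tau>) - integral {0..\<sigma>} (\<Phi> \<sigma>) - (\<tau> - \<sigma>) *\<^sub>R (\<Phi> \<sigma> \<sigma> + integral {0..\<sigma>} (\<Psi> \<sigma>))) \<le> \<epsilon> * (\<tau> - \<sigma>)"
    if st: "0 \<le> \<sigma>" "\<sigma> < \<tau>" "\<tau> \<le> T" "\<tau> - \<sigma> < min \<eta>1 \<eta>2" for \<sigma> \<tau>
  proof -
    have i1: "\<Phi> \<tau> integrable_on {a..b}" if "0 \<le> a" "b \<le> \<tau>" for a b
      by (intro integrable_continuous_interval continuous_on_subset[OF cs(1)[OF st(3)]]) (use that in auto)
    have i2: "\<Phi> \<sigma> integrable_on {0..\<sigma>}" and i3: "\<Psi> \<sigma> integrable_on {0..\<sigma>}"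
      by (intro integrable_continuous_interval cs; use st in auto)+
    have 1: "norm (integral {\<sigma>..\<tau>} (\<lambda>s. \<Phi> \<tau> s - \<Phi> \<sigma> \<sigma>)) \<le> (\<tau> - \<sigma>) * e"
      by (rule norm_integral_le_const) (use st i1 in \<open>auto intro!: \<eta>1(2) integrable_diff\<close>)
    have 2: "norm (integral {0..\<sigma>} (\<lambda>s. \<Phi> \<tau> s - \<Phi> \<sigma> s - (\<tau> - \<sigma>) *\<^sub>R \<Psi> \<sigma> s)) \<le> (\<sigma> - 0) * ((\<tau> - \<sigma>) * e)"
    proof (rule norm_integral_le_const)
      show "(\<lambda>s. \<Phi> \<tau> s - \<Phi> \<sigma> s - (\<tau> - \<sigma>) *\<^sub>R \<Psi> \<sigma> s) integrable_on {0..\<sigma>}"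
        using st by (intro integrable_diff integrable_cmul i1 i2 i3) auto
      fix s assume s: "s \<in> {0..\<sigma>}"
      \<comment> \<open>Integrating the derivative for fixed \<open>s\<close> makes the remainder
        small uniformly in \<open>s\<close>.\<close>
      have h: "((\<lambda>\<rho>. \<Psi> \<rho> s) has_integral (\<Phi> \<tau> s - \<Phi> \<sigma> s)) {\<sigma>..\<tau>}"
        by (rule fundamental_theorem_of_calculus)
           (use st s in \<open>auto intro!: has_vector_derivative_within_subset[OF der]\<close>)
      have h': "((\<lambda>\<rho>. \<Psi> \<rho> s - \<Psi> \<sigma> s) has_integral (\<Phi> \<tau> s - \<Phi> \<sigma> s - (\<tau> - \<sigma>) *\<^sub>R \<Psi> \<sigma> s)) {\<sigma>..\<tau>}"
        using has_integral_diff[OF h has_integral_const_real[of "\<Psi> \<sigma> s" \<sigma> \<tau>]] st by simp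
      have "norm (integral {\<sigma>..\<tau>} (\<lambda>\<rho>. \<Psi> \<rho> s - \<Psi> \<sigma> s)) \<le> (\<tau> - \<sigma>) * e"
        by (rule norm_integral_le_const) (use st s \<eta>2(1) h' in \<open>auto intro!: \<eta>2(2)\<close>)
      then show "norm (\<Phi> \<tau> s - \<Phi> \<sigma> s - (\<tau> - \<sigma>) *\<^sub>R \<Psi> \<sigma> s) \<le> (\<tau> - \<sigma>) * e"
        using integral_unique[OF h'] by simp
    qed (use st in auto)
    have "integral {0..\<tau>} (\<Phi> \<tau>) = integral {0..\<sigma>} (\<Phi> \<tau>) + integral {\<sigma>..\<tau>} (\<Phi> \<tau>)"
      by (rule Henstock_Kurzweil_Integration.integral_combine[symmetric]) (use st i1 in auto)
    moreover have "integral {\<sigma>..\<tau>} (\<lambda>s. \<Phi> \<tau> s - \<Phi> \<sigma> \<sigma>) = integral {\<sigma>..\<tau>} (\<Phi> \<tau>) - (\<tau> - \<sigma>) *\<^sub>R \<Phi> \<sigma> \<sigma>"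
      using st by (subst Henstock_Kurzweil_Integration.integral_diff) (auto intro!: i1)
    moreover have "integral {0..\<sigma>} (\<lambda>s. \<Phi> \<tau> s - \<Phi> \<sigma> s - (\<tau> - \<sigma>) *\<^sub>R \<Psi> \<sigma> s)
        = integral {0..\<sigma>} (\<Phi> \<tau>) - integral {0..\<sigma>} (\<Phi> \<sigma>) - (\<tau> - \<sigma>) *\<^sub>R integral {0..\<sigma>} (\<Psi> \<sigma>)"
    proof -
      have i: "\<Phi> \<tau> integrable_on {0..\<sigma>}" using st by (intro i1) auto
      show ?thesis
        using Henstock_Kurzweil_Integration.integral_diff[OF integrable_diff[OF i i2] integrable_cmul[OF i3, of "\<tau> - \<sigma>"]]
          Henstock_Kurzweil_Integration.integral_diff[OF i i2]
        by simp
    qed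
    ultimately have "integral {0..\<tau>} (\<Phi> \<tau>) - integral {0..\<sigma>} (\<Phi> \<sigma>) - (\<tau> - \<sigma>) *\<^sub>R (\<Phi> \<sigma> \<sigma> + integral {0..\<sigma>} (\<Psi> \<sigma>))
      = integral {\<sigma>..\<tau>} (\<lambda>s. \<Phi> \<tau> s - \<Phi> \<sigma> \<sigma>) + integral {0..\<sigma>} (\<lambda>s. \<Phi> \<tau> s - \<Phi> \<sigma> s - (\<tau> - \<sigma>) *\<^sub>R \<Psi> \<sigma> s)"
      by (simp add: algebra_simps)
    also have "norm \<dots> \<le> (\<tau> - \<sigma>) * e + (\<sigma> - 0) * ((\<tau> - \<sigma>) * e)"
      using norm_triangle_ineq 1 2 by (meson add_mono order_trans)
    also have "\<dots> \<le> (1 + \<bar>T\<bar>) * e * (\<tau> - \<sigma>)"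
    proof -
      have "\<sigma> * ((\<tau> - \<sigma>) * e) \<le> \<bar>T\<bar> * ((\<tau> - \<sigma>) * e)"
        by (rule mult_right_mono) (use st e in auto)
      then show ?thesis by (simp add: algebra_simps)
    qed
    finally show ?thesis by (simp only: ce)
  qed
  then show "\<exists>\<delta>>0. \<forall>\<sigma> \<tau>. 0 \<le> \<sigma> \<longrightarrow> \<sigma> < \<tau> \<longrightarrow> \<tau> \<le> T \<longrightarrow> \<tau> - \<sigma> < \<delta> \<longrightarrow>
      norm (integral {0..\<tau>} (\<Phi> \<tau>) - integral {0..\<sigma>} (\<Phi> \<sigma>) - (\<tau> - \<sigma>) *\<^sub>R (\<Phi> \<sigma> \<sigma> + integral {0..\<sigma>} (\<Psi> \<sigma>))) \<le> \<epsilon> * (\<tau> - \<sigma>)"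
    using \<eta>1(1) \<eta>2(1) by (intro exI[of _ "min \<eta>1 \<eta>2"]) auto
qed

subsection \<open>Hermitian symmetry of the resolvent kernel\<close>

lemma ctranspose_herm_kernel: "x \<noteq> 0 \<Longrightarrow> ctranspose (herm_kernel A x) = herm_kernel A (- x)"
  by (auto simp: herm_kernel_def)

lemma borel_measurable_herm_kernel [measurable]:
  assumes "continuous_on UNIV A"
  shows "herm_kernel A \<in> borel_measurable borel"
proof -
  have "kernel_cont A \<in> borel_measurable borel"
    by (intro borel_measurable_continuous_onI continuous_kernel_cont assms)
  then have "(\<lambda>x. kernel_cont A x + (if 0 \<le> x then A 0 - ctranspose (A 0) else 0)) \<in> borel_measurable borel"
    by measurable
  then show ?thesis by (simp flip: herm_kernel_split)
qed

lemma borel_measurable_mmult: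
  fixes f g :: "'a \<Rightarrow> 'r::finite cmat"
  assumes "f \<in> borel_measurable M" "g \<in> borel_measurable M"
  shows "(\<lambda>x. f x ** g x) \<in> borel_measurable M"
  by (rule borel_measurable_continuous_Pair[OF assms])
     (intro mmult.continuous_on continuous_intros)

lemma borel_measurable_ctranspose:
  assumes "f \<in> borel_measurable M"
  shows "(\<lambda>x. ctranspose (f x)) \<in> borel_measurable M"
  using assms by (rule borel_measurable_continuous_on[rotated]) (intro continuous_on_ctranspose continuous_intros)

lemma set_integrable_bounded_interval:
  fixes f :: "real \<Rightarrow> 'a::euclidean_space"
  assumes "f \<in> borel_measurable borel" "\<And>x. x \<in> {a..b} \<Longrightarrow> norm (f x) \<le> B"
  shows "set_integrable lborel {a..b} f"
    and "f integrable_on {a..b}"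
    and "(LINT x:{a..b}|lborel. f x) = integral {a..b} f"
proof -
  show i: "set_integrable lborel {a..b} f"
    unfolding set_integrable_def
    by (rule integrableI_bounded_set[where A = "{a..b}" and B = B])
       (use assms in \<open>auto simp: emeasure_lborel_Icc_eq\<close>)
  show "f integrable_on {a..b}" "(LINT x:{a..b}|lborel. f x) = integral {a..b} f"
    using set_borel_integral_eq_integral[OF i] by auto
qed

lemma norm_ctranspose_bound: "\<exists>K\<ge>0. \<forall>X :: 'r::finite cmat. norm (ctranspose X) \<le> K * norm X"
  using bounded_linear.nonneg_bounded[OF bounded_linear_ctranspose] by (metis mult.commute)

lemma conv_self_adjoint:
  fixes F G :: "real \<Rightarrow> 'r::finite cmat"
  assumes A: "continuous_on UNIV A"
    and F: "F \<in> borel_measurable borel" "\<And>x. norm (F x) \<le> M"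
    and G: "G \<in> borel_measurable borel" "\<And>x. norm (G x) \<le> N"
  shows "integral {0..\<tau>} (\<lambda>x. ctranspose (F x) ** conv A \<tau> G x)
       = integral {0..\<tau>} (\<lambda>y. ctranspose (conv A \<tau> F y) ** G y)"
proof -
  note [measurable] = F(1) G(1) borel_measurable_herm_kernel[OF A]
  obtain \<kappa> where \<kappa>: "0 \<le> \<kappa>" "\<And>x. x \<in> {-\<tau>..\<tau>} \<Longrightarrow> norm (herm_kernel A x) \<le> \<kappa>"
    using herm_kernel_bounded[OF A] by blast
  obtain c where c: "0 \<le> c" "\<And>X :: 'r cmat. norm (ctranspose X) \<le> c * norm X"
    using norm_ctranspose_bound by metis
  have M: "0 \<le> M" using F(2)[of 0] norm_ge_zero by (rule order_trans[rotated])
  have N: "0 \<le> N" using G(2)[of 0] norm_ge_zero by (rule order_trans[rotated])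
  define \<phi> where "\<phi> x y = ctranspose (F x) ** herm_kernel A (x - y) ** G y" for x y
  have \<phi>_bound: "norm (\<phi> x y) \<le> c * M * \<kappa> * N" if "x \<in> {0..\<tau>}" "y \<in> {0..\<tau>}" for x y
  proof -
    have "norm (ctranspose (F x)) \<le> c * M"
      using c(2)[of "F x"] mult_left_mono[OF F(2)[of x] c(1)] by linarith
    moreover have "norm (herm_kernel A (x - y)) \<le> \<kappa>" using that by (intro \<kappa>) auto
    ultimately have "norm (ctranspose (F x) ** herm_kernel A (x - y)) \<le> c * M * \<kappa>"
      by (intro order_trans[OF norm_matrix_mult_le] mult_mono) (use c M in auto)
    moreover have "0 \<le> c * M * \<kappa>" using c(1) M \<kappa>(1) by simp
    ultimately show ?thesis
      unfolding \<phi>_def by (rule order_trans[OF norm_matrix_mult_le mult_mono[OF _ G(2) _ norm_ge_zero]])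
  qed
  have FK: "norm (herm_kernel A (y - x) ** F x) \<le> \<kappa> * M" "norm (herm_kernel A (y - x) ** G x) \<le> \<kappa> * N"
    if "x \<in> {0..\<tau>}" "y \<in> {0..\<tau>}" for x y
    by (rule order_trans[OF norm_matrix_mult_le]; use that \<kappa> in \<open>auto intro!: mult_mono F G\<close>)+
  have m1: "(\<lambda>y. \<phi> x y) \<in> borel_measurable borel" for x
    unfolding \<phi>_def by (intro borel_measurable_mmult) measurable
  have m2: "(\<lambda>x. \<phi> x y) \<in> borel_measurable borel" for y
    unfolding \<phi>_def by (intro borel_measurable_mmult borel_measurable_ctranspose) measurable
  have FKi: "(\<lambda>x. herm_kernel A (y - x) ** F x) integrable_on {0..\<tau>}" if "y \<in> {0..\<tau>}" for y
    by (rule set_integrable_bounded_interval(2)[OF borel_measurable_mmult FK(1)]) (use that in auto)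
  have GKi: "(\<lambda>x. herm_kernel A (y - x) ** G x) integrable_on {0..\<tau>}" if "y \<in> {0..\<tau>}" for y
    by (rule set_integrable_bounded_interval(2)[OF borel_measurable_mmult FK(2)]) (use that in auto)
  let ?\<Phi> = "\<lambda>x y. indicat_real {0..\<tau>} x *\<^sub>R (indicat_real {0..\<tau>} y *\<^sub>R \<phi> x y)"
  have int: "integrable (lborel \<Otimes>\<^sub>M lborel) (\<lambda>(x, y). ?\<Phi> x y)"
  proof (rule integrableI_bounded_set[where A = "{0..\<tau>} \<times> {0..\<tau>}" and B = "c * M * \<kappa> * N"])
    have "(\<lambda>p. \<phi> (fst p) (snd p)) \<in> borel_measurable (borel \<Otimes>\<^sub>M borel)"
      unfolding \<phi>_def by (intro borel_measurable_mmult borel_measurable_ctranspose) measurable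
    then show "(\<lambda>(x, y). ?\<Phi> x y) \<in> borel_measurable (lborel \<Otimes>\<^sub>M lborel)"
      unfolding split_def by (intro borel_measurable_scaleR) measurable
    show "emeasure (lborel \<Otimes>\<^sub>M lborel) ({0..\<tau>} \<times> {0..\<tau>}) < \<infinity>"
      by (subst lborel.emeasure_pair_measure_Times) (auto simp: emeasure_lborel_Icc_eq ennreal_mult_less_top)
    show "AE p in lborel \<Otimes>\<^sub>M lborel. p \<in> {0..\<tau>} \<times> {0..\<tau>} \<longrightarrow> norm (case p of (x, y) \<Rightarrow> ?\<Phi> x y) \<le> c * M * \<kappa> * N"
      using \<phi>_bound by auto
  qed (auto simp: indicator_def)
  have in1: "(\<integral>y. ?\<Phi> x y \<partial>lborel) = indicat_real {0..\<tau>} x *\<^sub>R (ctranspose (F x) ** conv A \<tau> G x)" for x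
  proof (cases "x \<in> {0..\<tau>}")
    case True
    have "(\<integral>y. ?\<Phi> x y \<partial>lborel) = (LINT y:{0..\<tau>}|lborel. \<phi> x y)"
      using True by (simp add: set_lebesgue_integral_def)
    also have "\<dots> = integral {0..\<tau>} (\<phi> x)"
      by (rule set_integrable_bounded_interval(3)[OF m1 \<phi>_bound[OF True]])
    also have "\<dots> = ctranspose (F x) ** conv A \<tau> G x"
      unfolding \<phi>_def[abs_def] conv_def using integral_mmult_right[OF GKi[OF True]]
      by (simp add: matrix_mul_assoc)
    finally show ?thesis using True by simp
  qed auto
  have in2: "(\<integral>x. ?\<Phi> x y \<partial>lborel) = indicat_real {0..\<tau>} y *\<^sub>R (ctranspose (conv A \<tau> F y) ** G y)" for y
  proof (cases "y \<in> {0..\<tau>}")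
    case True
    have "(\<integral>x. ?\<Phi> x y \<partial>lborel) = (LINT x:{0..\<tau>}|lborel. \<phi> x y)"
      using True by (simp add: set_lebesgue_integral_def)
    also have "\<dots> = integral {0..\<tau>} (\<lambda>x. \<phi> x y)"
      by (rule set_integrable_bounded_interval(3)[OF m2 \<phi>_bound[OF _ True]])
    \<comment> \<open>Hermitian symmetry of the kernel fails only at the origin, that is at x =
      y.\<close>
    also have "\<dots> = integral {0..\<tau>} (\<lambda>x. ctranspose (herm_kernel A (y - x) ** F x) ** G y)"
      by (rule integral_spike[of "{y}"]) (auto simp: \<phi>_def ctranspose_mult ctranspose_herm_kernel)
    also have "\<dots> = ctranspose (conv A \<tau> F y) ** G y"
      unfolding conv_def
      using integral_mmult_left[OF integrable_linear[OF FKi[OF True] bounded_linear_ctranspose], of "G y"]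
        integral_ctranspose[OF FKi[OF True]]
      by (simp add: o_def)
    finally show ?thesis using True by simp
  qed auto
  \<comment> \<open>Fubini itself supplies the integrability of the outer integrands, including the
    measurability of the convolutions.\<close>
  have o1: "set_integrable lborel {0..\<tau>} (\<lambda>x. ctranspose (F x) ** conv A \<tau> G x)"
    using lborel_pair.integrable_fst[OF int] by (simp only: in1 set_integrable_def)
  have o2: "set_integrable lborel {0..\<tau>} (\<lambda>y. ctranspose (conv A \<tau> F y) ** G y)"
    using lborel_pair.integrable_snd[OF int] by (simp only: in2 set_integrable_def)
  have "integral {0..\<tau>} (\<lambda>x. ctranspose (F x) ** conv A \<tau> G x) = (\<integral>x. (\<integral>y. ?\<Phi> x y \<partial>lborel) \<partial>lborel)"
    using set_borel_integral_eq_integral(2)[OF o1] by (simp only: in1 set_lebesgue_integral_def)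
  also have "\<dots> = (\<integral>y. (\<integral>x. ?\<Phi> x y \<partial>lborel) \<partial>lborel)"
    by (rule lborel_pair.Fubini_integral[OF int, symmetric])
  also have "\<dots> = integral {0..\<tau>} (\<lambda>y. ctranspose (conv A \<tau> F y) ** G y)"
    using set_borel_integral_eq_integral(2)[OF o2] by (simp only: in2 set_lebesgue_integral_def)
  finally show ?thesis .
qed

text \<open>One length and an arbitrary resolvent kernel for it. The results are used both for the
  given kernel and for the one that the definition of an accelerant provides for
  \<open>v\<close>.\<close>

locale resolvent =
  fixes A k :: "real \<Rightarrow> 'r::finite cmat" and T \<tau> :: real and \<gamma> :: "real \<Rightarrow> real \<Rightarrow> 'r cmat"
  assumes A_cont: "continuous_on UNIV A" and \<tau>: "0 < \<tau>" "\<tau> \<le> T"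
    and k_eq: "\<And>x. x \<in> {-T..T} \<Longrightarrow> k x = herm_kernel A x"
    and resolvent: "is_resolvent_kernel k \<tau> \<gamma>"
begin

lemma resolvent_eq:
  assumes "t \<in> {0..\<tau>}" "s \<in> {0..\<tau>}"
  shows "\<gamma> t s = herm_kernel A (t - s) + conv A \<tau> (\<lambda>\<xi>. \<gamma> \<xi> s) t"
proof -
  have "\<gamma> t s - integral {0..\<tau>} (\<lambda>\<xi>. k (t - \<xi>) ** \<gamma> \<xi> s) = k (t - s)"
    using resolvent assms by (auto simp: is_resolvent_kernel_def)
  moreover have "integral {0..\<tau>} (\<lambda>\<xi>. k (t - \<xi>) ** \<gamma> \<xi> s) = conv A \<tau> (\<lambda>\<xi>. \<gamma> \<xi> s) t"
    unfolding conv_def by (rule integral_cong) (use assms \<tau> in \<open>auto simp: k_eq\<close>)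
  moreover have "k (t - s) = herm_kernel A (t - s)" using assms \<tau> by (intro k_eq) auto
  ultimately show ?thesis by (simp add: algebra_simps)
qed

lemma lower_continuous:
  obtains g where "continuous_on {(t, s). 0 \<le> s \<and> s \<le> t \<and> t \<le> \<tau>} g"
    "\<And>t s. 0 \<le> s \<Longrightarrow> s < t \<Longrightarrow> t \<le> \<tau> \<Longrightarrow> g (t, s) = \<gamma> t s"
  using resolvent unfolding is_resolvent_kernel_def by blast

lemma upper_continuous:
  obtains g where "continuous_on {(t, s). 0 \<le> t \<and> t \<le> s \<and> s \<le> \<tau>} g"
    "\<And>t s. 0 \<le> t \<Longrightarrow> t < s \<Longrightarrow> s \<le> \<tau> \<Longrightarrow> g (t, s) = \<gamma> t s"
  using resolvent unfolding is_resolvent_kernel_def by blast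

text \<open>The continuous extensions from the two triangles are glued, with value 0 at the diagonal
  point and outside the interval. The result is bounded and Borel on the whole line and represents
  the column under the integral.\<close>

lemma column_measurable:
  assumes s: "s \<in> {0..\<tau>}"
  obtains F M where "F \<in> borel_measurable borel" "\<And>x. norm (F x) \<le> M"
    "\<And>x. x \<in> {0..\<tau>} - {s} \<Longrightarrow> F x = \<gamma> x s"
proof -
  obtain g where g: "continuous_on {(t, s). 0 \<le> s \<and> s \<le> t \<and> t \<le> \<tau>} g"
    "\<And>t s. 0 \<le> s \<Longrightarrow> s < t \<Longrightarrow> t \<le> \<tau> \<Longrightarrow> g (t, s) = \<gamma> t s" by (rule lower_continuous) blast
  obtain h where h: "continuous_on {(t, s). 0 \<le> t \<and> t \<le> s \<and> s \<le> \<tau>} h"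
    "\<And>t s. 0 \<le> t \<Longrightarrow> t < s \<Longrightarrow> s \<le> \<tau> \<Longrightarrow> h (t, s) = \<gamma> t s" by (rule upper_continuous) blast
  have cg: "continuous_on {s..\<tau>} (\<lambda>x. g (x, s))"
    by (rule continuous_on_compose2[OF g(1)]) (use s in \<open>auto intro!: continuous_intros\<close>)
  have ch: "continuous_on {0..s} (\<lambda>x. h (x, s))"
    by (rule continuous_on_compose2[OF h(1)]) (use s in \<open>auto intro!: continuous_intros\<close>)
  define F where "F x = indicat_real {s<..\<tau>} x *\<^sub>R g (x, s) + indicat_real {0..<s} x *\<^sub>R h (x, s)" for x
  have "bounded ((\<lambda>x. g (x, s)) ` {s..\<tau>} \<union> (\<lambda>x. h (x, s)) ` {0..s})"
    by (intro compact_imp_bounded compact_Un compact_continuous_image cg ch) auto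
  then obtain M where M: "\<forall>X\<in>(\<lambda>x. g (x, s)) ` {s..\<tau>} \<union> (\<lambda>x. h (x, s)) ` {0..s}. norm X \<le> M"
    unfolding bounded_iff by blast
  have "norm (F x) \<le> max M 0" for x
    using M by (auto simp: F_def indicator_def max.coboundedI1)
  moreover have "F \<in> borel_measurable borel"
    unfolding F_def[abs_def]
    by (intro borel_measurable_add borel_measurable_continuous_on_indicator
         continuous_on_subset[OF cg] continuous_on_subset[OF ch]) auto
  moreover have "F x = \<gamma> x s" if "x \<in> {0..\<tau>} - {s}" for x
    using that s g(2)[of s x] h(2)[of x s] by (auto simp: F_def indicator_def)
  ultimately show ?thesis using that by blast
qed

text \<open>Let F and G be the columns at t and s, and K the convolution. Pairing F with the
  equation of G, and the equation of F with G, the common integral of adjoint(F) G cancels because K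
  is self-adjoint. What remains says that (K F)(s) and (K G)(t) are adjoint to each other; the
  resolvent equation turns these into \<gamma>(s, t) and \<gamma>(t, s) up to kernel values, which
  are adjoint since t and s differ.\<close>

lemma hermitian:
  assumes t: "t \<in> {0..\<tau>}" and s: "s \<in> {0..\<tau>}" and ne: "t \<noteq> s"
  shows "\<gamma> t s = ctranspose (\<gamma> s t)"
proof -
  obtain F M where F: "F \<in> borel_measurable borel" "\<And>x. norm (F x) \<le> M"
    "\<And>x. x \<in> {0..\<tau>} - {t} \<Longrightarrow> F x = \<gamma> x t" by (rule column_measurable[OF t]) blast
  obtain G N where G: "G \<in> borel_measurable borel" "\<And>x. norm (G x) \<le> N"
    "\<And>x. x \<in> {0..\<tau>} - {s} \<Longrightarrow> G x = \<gamma> x s" by (rule column_measurable[OF s]) blast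
  note [measurable] = F(1) G(1) borel_measurable_herm_kernel[OF A_cont]
  have cF: "conv A \<tau> F x = \<gamma> x t - herm_kernel A (x - t)" if "x \<in> {0..\<tau>}" for x
    using resolvent_eq[OF that t] conv_cong[of \<tau> "{t}" F "\<lambda>x. \<gamma> x t" A x] F(3) by simp
  have cG: "conv A \<tau> G x = \<gamma> x s - herm_kernel A (x - s)" if "x \<in> {0..\<tau>}" for x
    using resolvent_eq[OF that s] conv_cong[of \<tau> "{s}" G "\<lambda>x. \<gamma> x s" A x] G(3) by simp
  obtain \<kappa> where \<kappa>: "0 \<le> \<kappa>" "\<And>x. x \<in> {-\<tau>..\<tau>} \<Longrightarrow> norm (herm_kernel A x) \<le> \<kappa>"
    using herm_kernel_bounded[OF A_cont] by blast
  obtain c where c: "0 \<le> c" "\<And>X :: 'r cmat. norm (ctranspose X) \<le> c * norm X"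
    using norm_ctranspose_bound by metis
  have M: "0 \<le> M" using F(2)[of 0] norm_ge_zero by (rule order_trans[rotated])
  have N: "0 \<le> N" using G(2)[of 0] norm_ge_zero by (rule order_trans[rotated])
  have tr: "norm (ctranspose X) \<le> c * b" if "norm X \<le> b" for X :: "'r cmat" and b
    using c(2)[of X] mult_left_mono[OF that c(1)] by linarith
  have FG: "(\<lambda>x. ctranspose (F x) ** G x) integrable_on {0..\<tau>}"
  proof (rule set_integrable_bounded_interval(2))
    show "norm (ctranspose (F x) ** G x) \<le> (c * M) * N" for x
      by (intro order_trans[OF norm_matrix_mult_le] mult_mono tr F G) (use c M N in auto)
  qed (intro borel_measurable_mmult borel_measurable_ctranspose F G)
  have FK: "(\<lambda>x. ctranspose (F x) ** herm_kernel A (x - s)) integrable_on {0..\<tau>}"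
  proof (rule set_integrable_bounded_interval(2))
    show "norm (ctranspose (F x) ** herm_kernel A (x - s)) \<le> (c * M) * \<kappa>" if "x \<in> {0..\<tau>}" for x
      by (intro order_trans[OF norm_matrix_mult_le] mult_mono tr F \<kappa>) (use c M N s that in auto)
  qed (intro borel_measurable_mmult borel_measurable_ctranspose, measurable)
  have KG: "(\<lambda>x. ctranspose (herm_kernel A (x - t)) ** G x) integrable_on {0..\<tau>}"
  proof (rule set_integrable_bounded_interval(2))
    show "norm (ctranspose (herm_kernel A (x - t)) ** G x) \<le> (c * \<kappa>) * N" if "x \<in> {0..\<tau>}" for x
      by (intro order_trans[OF norm_matrix_mult_le] mult_mono tr G \<kappa>) (use c \<kappa>(1) N t that in auto)
  qed (intro borel_measurable_mmult borel_measurable_ctranspose, measurable)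
  have KF: "(\<lambda>x. herm_kernel A (s - x) ** F x) integrable_on {0..\<tau>}"
  proof (rule set_integrable_bounded_interval(2))
    show "norm (herm_kernel A (s - x) ** F x) \<le> \<kappa> * M" if "x \<in> {0..\<tau>}" for x
      by (intro order_trans[OF norm_matrix_mult_le] mult_mono F \<kappa>) (use c \<kappa>(1) N s that in auto)
  qed (intro borel_measurable_mmult, measurable)
  have 1: "integral {0..\<tau>} (\<lambda>x. ctranspose (F x) ** conv A \<tau> G x)
      = integral {0..\<tau>} (\<lambda>x. ctranspose (F x) ** G x) - integral {0..\<tau>} (\<lambda>x. ctranspose (F x) ** herm_kernel A (x - s))"
    unfolding Henstock_Kurzweil_Integration.integral_diff[OF FG FK, symmetric]
    by (rule integral_spike[of "{s}"]) (auto simp: cG G(3) mmult.diff_right)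
  have 2: "integral {0..\<tau>} (\<lambda>x. ctranspose (conv A \<tau> F x) ** G x)
      = integral {0..\<tau>} (\<lambda>x. ctranspose (F x) ** G x) - integral {0..\<tau>} (\<lambda>x. ctranspose (herm_kernel A (x - t)) ** G x)"
    unfolding Henstock_Kurzweil_Integration.integral_diff[OF FG KG, symmetric]
    by (rule integral_spike[of "{t}"]) (auto simp: cF F(3) mmult.diff_left)
  have "integral {0..\<tau>} (\<lambda>x. ctranspose (F x) ** herm_kernel A (x - s))
      = integral {0..\<tau>} (\<lambda>x. ctranspose (herm_kernel A (s - x) ** F x))"
    by (rule integral_spike[of "{s}"]) (auto simp: ctranspose_mult ctranspose_herm_kernel)
  also have "\<dots> = ctranspose (conv A \<tau> F s)"
    unfolding conv_def by (rule integral_ctranspose[OF KF])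
  finally have 3: "integral {0..\<tau>} (\<lambda>x. ctranspose (F x) ** herm_kernel A (x - s)) = ctranspose (conv A \<tau> F s)" .
  have 4: "integral {0..\<tau>} (\<lambda>x. ctranspose (herm_kernel A (x - t)) ** G x) = conv A \<tau> G t"
    unfolding conv_def by (rule integral_spike[of "{t}"]) (auto simp: ctranspose_herm_kernel)
  have "ctranspose (conv A \<tau> F s) = conv A \<tau> G t"
    using conv_self_adjoint[OF A_cont F(1,2) G(1,2), of \<tau>] 1 2 3 4 by simp
  then have "ctranspose (\<gamma> s t) - ctranspose (herm_kernel A (s - t)) = \<gamma> t s - herm_kernel A (t - s)"
    using cF[OF s] cG[OF t] by simp
  then show ?thesis using ne ctranspose_herm_kernel[of "s - t" A] by simp
qed

end

subsection \<open>First and last column of the resolvent kernel\<close>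

text \<open>The right side of the equation makes sense for every \<open>t\<close> and is taken as
  definition of \<open>p\<close>. It can differ from \<open>G\<close> on \<open>[0, \<tau>]\<close>
  only at 0, where the resolvent equation involves the diagonal, and the integral does not see this
  point.\<close>

lemma resolvent_column_extend:
  assumes A: "continuous_on UNIV A" and \<tau>: "0 \<le> \<tau>" "\<tau> \<le> T" and G: "continuous_on {0..\<tau>} G"
    and eq: "\<And>s. s \<in> {0<..\<tau>} \<Longrightarrow> G s = A s + conv A \<tau> G s"
  obtains p where "continuous_on {0..T} p" "\<And>t. p t = A t + conv A \<tau> p t"
    "\<And>s. s \<in> {0<..\<tau>} \<Longrightarrow> p s = G s"
proof
  let ?p = "\<lambda>t. A t + conv A \<tau> G t"
  show "continuous_on {0..T} ?p"
    by (intro continuous_on_add continuous_on_subset[OF A] continuous_on_subset[OF conv_continuous[OF A G \<tau>(1)]]) auto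
  show "?p t = A t + conv A \<tau> ?p t" for t
    using conv_cong[of \<tau> "{0}" G ?p A t] eq by simp
  show "?p s = G s" if "s \<in> {0<..\<tau>}" for s
    using eq[OF that] by simp
qed

context resolvent
begin

lemma first_column:
  obtains p where "continuous_on {0..T} p" "\<And>t. p t = A t + conv A \<tau> p t"
    "\<And>s. s \<in> {0<..\<tau>} \<Longrightarrow> p s = \<gamma> s 0"
proof -
  obtain g where g: "continuous_on {(t, s). 0 \<le> s \<and> s \<le> t \<and> t \<le> \<tau>} g"
    "\<And>t s. 0 \<le> s \<Longrightarrow> s < t \<Longrightarrow> t \<le> \<tau> \<Longrightarrow> g (t, s) = \<gamma> t s" by (rule lower_continuous) blast
  let ?G = "\<lambda>x. g (x, 0)"
  have c: "continuous_on {0..\<tau>} ?G"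
    by (rule continuous_on_compose2[OF g(1)]) (auto intro!: continuous_intros)
  have eq: "?G s = A s + conv A \<tau> ?G s" if "s \<in> {0<..\<tau>}" for s
    using resolvent_eq[of s 0] conv_cong[of \<tau> "{0}" ?G "\<lambda>x. \<gamma> x 0" A s] g(2)[of 0] that \<tau>
    by (auto simp: herm_kernel_def)
  obtain p where p: "continuous_on {0..T} p" "\<And>t. p t = A t + conv A \<tau> p t" "\<And>s. s \<in> {0<..\<tau>} \<Longrightarrow> p s = ?G s"
    by (rule resolvent_column_extend[OF A_cont less_imp_le[OF \<tau>(1)] \<tau>(2) c eq]) (assumption, rule that)
  have "p s = \<gamma> s 0" if "s \<in> {0<..\<tau>}" for s
    using p(3)[of s] g(2)[of 0 s] that by simp
  with p(1,2) show ?thesis by (rule that)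
qed

text \<open>The reflection sends the diagonal point \<tau> of the column to 0 and the kernel to its
  adjoint, so the extension used for the first column applies.\<close>

lemma last_column:
  obtains q where "continuous_on {0..T} q" "\<And>t. q t = ctranspose (A t) + conv (adj A) \<tau> q t"
    "\<And>s. s \<in> {0<..\<tau>} \<Longrightarrow> q s = \<gamma> (\<tau> - s) \<tau>"
proof -
  obtain g where g: "continuous_on {(t, s). 0 \<le> t \<and> t \<le> s \<and> s \<le> \<tau>} g"
    "\<And>t s. 0 \<le> t \<Longrightarrow> t < s \<Longrightarrow> s \<le> \<tau> \<Longrightarrow> g (t, s) = \<gamma> t s" by (rule upper_continuous) blast
  let ?G = "\<lambda>x. g (\<tau> - x, \<tau>)"
  have c: "continuous_on {0..\<tau>} ?G"
    by (rule continuous_on_compose2[OF g(1)]) (auto intro!: continuous_intros)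
  have eq: "?G s = ctranspose (A s) + conv (adj A) \<tau> ?G s" if s: "s \<in> {0<..\<tau>}" for s
  proof -
    have "?G s = \<gamma> (\<tau> - s) \<tau>" using s g(2) by auto
    also have "\<dots> = herm_kernel A (- s) + conv A \<tau> (\<lambda>\<xi>. \<gamma> \<xi> \<tau>) (\<tau> - s)"
      using resolvent_eq[of "\<tau> - s" \<tau>] s \<tau> by simp
    also have "conv A \<tau> (\<lambda>\<xi>. \<gamma> \<xi> \<tau>) (\<tau> - s) = conv (adj A) \<tau> (\<lambda>x. \<gamma> (\<tau> - x) \<tau>) s"
      using conv_reflect[of A \<tau> "\<lambda>x. \<gamma> (\<tau> - x) \<tau>" "\<tau> - s"] by simp
    also have "\<dots> = conv (adj A) \<tau> ?G s"
      by (rule conv_cong[of _ "{0}"]) (use g(2) in auto)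
    finally show ?thesis using s by (simp add: herm_kernel_def)
  qed
  obtain q where q: "continuous_on {0..T} q" "\<And>t. q t = ctranspose (A t) + conv (adj A) \<tau> q t"
    "\<And>s. s \<in> {0<..\<tau>} \<Longrightarrow> q s = ?G s"
    by (rule resolvent_column_extend[OF continuous_on_ctranspose[OF A_cont] less_imp_le[OF \<tau>(1)] \<tau>(2) c eq]) (assumption, rule that)
  have "q s = \<gamma> (\<tau> - s) \<tau>" if "s \<in> {0<..\<tau>}" for s
    using q(3)[of s] g(2)[of "\<tau> - s" \<tau>] that by simp
  with q(1,2) show ?thesis by (rule that)
qed

end

text \<open>The difference solves the homogeneous equation, so the bound holds with every
  \<open>h > 0\<close>. This identifies columns that stem from different resolvent kernels of the
  same length.\<close>

lemma stable_unique:
  assumes A: "continuous_on UNIV A" and st: "stable A T C" and \<sigma>: "\<sigma> \<in> {0..T}"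
    and F: "continuous_on {0..\<sigma>} F" "\<And>t. t \<in> {0..\<sigma>} \<Longrightarrow> F t = H t + conv A \<sigma> F t"
    and G: "continuous_on {0..\<sigma>} G" "\<And>t. t \<in> {0..\<sigma>} \<Longrightarrow> G t = H t + conv A \<sigma> G t"
    and t: "t \<in> {0..\<sigma>}"
  shows "F t = G t"
proof -
  let ?D = "\<lambda>t. F t - G t"
  have z: "?D s - conv A \<sigma> ?D s = 0" if "s \<in> {0..\<sigma>}" for s
    using conv_diff[OF A F(1) G(1), of s] F(2)[OF that] G(2)[OF that] that by simp
  have le: "norm (?D t) \<le> C * h" if "0 < h" for h
    by (rule st[unfolded stable_def, rule_format, OF \<sigma>, where F = ?D])
       (use that z t in \<open>auto intro!: continuous_on_diff F G\<close>)
  have "norm (?D t) \<le> 0"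
  proof (rule field_le_epsilon)
    fix e :: real assume e: "0 < e"
    \<comment> \<open>The denominator allows any sign of \<open>C\<close>.\<close>
    have "C * (e / (\<bar>C\<bar> + 1)) \<le> e"
      using e mult_right_mono[of C "\<bar>C\<bar> + 1" e] by (simp add: divide_simps add_pos_nonneg algebra_simps)
    then show "norm (?D t) \<le> 0 + e" using le[of "e / (\<bar>C\<bar> + 1)"] e by (simp add: add_nonneg_pos)
  qed
  then show ?thesis by simp
qed

lemma accelerant_krein_pair:
  fixes k v :: "real \<Rightarrow> 'r::finite cmat"
  assumes T: "0 < T" and acc: "is_accelerant T k v"
    and res: "\<And>\<tau>. \<tau> \<in> {0<..T} \<Longrightarrow> is_resolvent_kernel k \<tau> (\<gamma> \<tau>)"
  obtains A C P Q where "krein_pair A T C P Q" "\<And>x. x \<in> {0..T} \<Longrightarrow> A x = k x"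
    "\<And>\<tau> s. \<tau> \<in> {0<..T} \<Longrightarrow> s \<in> {0<..\<tau>} \<Longrightarrow> \<gamma> \<tau> 0 s = ctranspose (P \<tau> s)"
    "\<And>\<tau> s. \<tau> \<in> {0<..T} \<Longrightarrow> s \<in> {0..<\<tau>} \<Longrightarrow> \<gamma> \<tau> \<tau> s = ctranspose (Q \<tau> (\<tau> - s))"
    "\<And>\<tau>. \<tau> \<in> {0..T} \<Longrightarrow> ctranspose (Q \<tau> \<tau>) = P \<tau> \<tau>"
    "\<And>\<tau>. \<tau> \<in> {0..T} \<Longrightarrow> v \<tau> = (- \<i>) *\<^sub>C P \<tau> \<tau>"
proof -
  \<comment> \<open>Constant continuation of \<open>k\<close> beyond both ends of
    \<open>[0, T]\<close> gives a function continuous on the whole line.\<close>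
  define A where "A x = k (max 0 (min T x))" for x
  have A: "continuous_on UNIV A"
    unfolding A_def[abs_def]
    by (rule continuous_on_compose2[where t = "{0..T}" and g = k])
       (use acc T in \<open>auto simp: is_accelerant_def intro!: continuous_intros\<close>)
  have Ak: "A x = k x" if "x \<in> {0..T}" for x using that by (simp add: A_def)
  have k: "k x = herm_kernel A x" if "x \<in> {-T..T}" for x
  proof (cases "0 \<le> x")
    case False
    then have "k (- (- x)) = ctranspose (k (- x))"
      using acc that unfolding is_accelerant_def by auto
    then show ?thesis using False that by (simp add: herm_kernel_def Ak)
  qed (use that in \<open>auto simp: herm_kernel_def Ak\<close>)
  have "\<exists>C\<ge>0. sup_bound A T C \<sigma>" if "\<sigma> \<in> {0..T}" for \<sigma>
  proof (cases "\<sigma> = 0")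
    case True then show ?thesis using sup_bound_zero by (metis zero_le_one)
  next
    case False
    then show ?thesis
      using sup_bound_if_invertible_on_L2[OF A _ _ k, of \<sigma>] that acc by (auto simp: is_accelerant_def)
  qed
  from sup_bound_uniform[OF A this] obtain C where C: "0 \<le> C" "\<forall>\<sigma>\<in>{0..T}. sup_bound A T C \<sigma>"
    by blast
  have st: "stable A T C" by (rule stable_if_sup_bound[OF A C(2)])
  have r: "resolvent A k T \<tau> \<delta>" if "\<tau> \<in> {0<..T}" "is_resolvent_kernel k \<tau> \<delta>" for \<tau> \<delta>
    using that A k by unfold_locales auto
  have "\<exists>p. continuous_on {0..T} p \<and> (\<forall>t. p t = A t + conv A \<tau> p t) \<and> (0 < \<tau> \<longrightarrow> (\<forall>s\<in>{0<..\<tau>}. p s = \<gamma> \<tau> s 0))"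
    if "\<tau> \<in> {0..T}" for \<tau>
  proof (cases "\<tau> = 0")
    \<comment> \<open>At length 0 the convolution vanishes, so the solution is \<open>A\<close>
      itself.\<close>
    case True
    then show ?thesis
      by (intro exI[of _ A]) (auto simp: conv_def intro!: continuous_on_subset[OF A])
  next
    case False
    then have "\<tau> \<in> {0<..T}" using that by auto
    from resolvent.first_column[OF r[OF this res[OF this]]] show ?thesis by metis
  qed
  then obtain P where P: "\<And>\<tau>. \<tau> \<in> {0..T} \<Longrightarrow> continuous_on {0..T} (P \<tau>)"
    "\<And>\<tau> t. \<tau> \<in> {0..T} \<Longrightarrow> P \<tau> t = A t + conv A \<tau> (P \<tau>) t"
    "\<And>\<tau> s. \<tau> \<in> {0..T} \<Longrightarrow> 0 < \<tau> \<Longrightarrow> s \<in> {0<..\<tau>} \<Longrightarrow> P \<tau> s = \<gamma> \<tau> s 0"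
    by metis
  have "\<exists>q. continuous_on {0..T} q \<and> (\<forall>t. q t = ctranspose (A t) + conv (adj A) \<tau> q t) \<and>
      (0 < \<tau> \<longrightarrow> (\<forall>s\<in>{0<..\<tau>}. q s = \<gamma> \<tau> (\<tau> - s) \<tau>))"
    if "\<tau> \<in> {0..T}" for \<tau>
  proof (cases "\<tau> = 0")
    case True
    then show ?thesis
      by (intro exI[of _ "adj A"]) (auto simp: conv_def intro!: continuous_on_ctranspose continuous_on_subset[OF A])
  next
    case False
    then have "\<tau> \<in> {0<..T}" using that by auto
    from resolvent.last_column[OF r[OF this res[OF this]]] show ?thesis by metis
  qed
  then obtain Q where Q: "\<And>\<tau>. \<tau> \<in> {0..T} \<Longrightarrow> continuous_on {0..T} (Q \<tau>)"
    "\<And>\<tau> t. \<tau> \<in> {0..T} \<Longrightarrow> Q \<tau> t = ctranspose (A t) + conv (adj A) \<tau> (Q \<tau>) t"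
    "\<And>\<tau> s. \<tau> \<in> {0..T} \<Longrightarrow> 0 < \<tau> \<Longrightarrow> s \<in> {0<..\<tau>} \<Longrightarrow> Q \<tau> s = \<gamma> \<tau> (\<tau> - s) \<tau>"
    by metis
  have pair: "krein_pair A T C P Q"
    by (intro krein_pair.intro krein_family.intro A C(1) st stable_adj P Q continuous_on_ctranspose)
  then interpret krein_pair A T C P Q .
  show ?thesis
  proof
    show "krein_pair A T C P Q" by (rule pair)
    show "A x = k x" if "x \<in> {0..T}" for x by (rule Ak[OF that])
    show "\<gamma> \<tau> 0 s = ctranspose (P \<tau> s)" if \<tau>: "\<tau> \<in> {0<..T}" and s: "s \<in> {0<..\<tau>}" for \<tau> s
      using resolvent.hermitian[OF r[OF \<tau> res[OF \<tau>]], of 0 s] P(3)[of \<tau> s] \<tau> s by auto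
    show "\<gamma> \<tau> \<tau> s = ctranspose (Q \<tau> (\<tau> - s))" if \<tau>: "\<tau> \<in> {0<..T}" and s: "s \<in> {0..<\<tau>}" for \<tau> s
      using resolvent.hermitian[OF r[OF \<tau> res[OF \<tau>]], of \<tau> s] Q(3)[of \<tau> "\<tau> - s"] \<tau> s by auto
    show "ctranspose (Q \<tau> \<tau>) = P \<tau> \<tau>" if \<tau>: "\<tau> \<in> {0..T}" for \<tau>
    proof (cases "\<tau> = 0")
      case True
      then show ?thesis using P(2)[of 0 0] Q(2)[of 0 0] T by (simp add: conv_def)
    next
      case False
      with \<tau> have \<tau>': "\<tau> \<in> {0<..T}" by auto
      show ?thesis
        using resolvent.hermitian[OF r[OF \<tau>' res[OF \<tau>']], of \<tau> 0] P(3)[of \<tau> \<tau>] Q(3)[of \<tau> \<tau>] \<tau>' by auto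
    qed
    \<comment> \<open>The definition expresses \<open>v\<close> through some kernel \<delta>, a
      priori not the given one; uniqueness identifies their first columns.\<close>
    have pos: "v \<tau> = (- \<i>) *\<^sub>C P \<tau> \<tau>" if \<tau>: "\<tau> \<in> {0<..T}" for \<tau>
    proof -
      obtain \<delta> where \<delta>: "is_resolvent_kernel k \<tau> \<delta>" "v \<tau> = (- \<i>) *\<^sub>C \<delta> \<tau> 0"
        using acc \<tau> unfolding is_accelerant_def by blast
      obtain p where p: "continuous_on {0..T} p" "\<And>t. p t = A t + conv A \<tau> p t"
        "\<And>s. s \<in> {0<..\<tau>} \<Longrightarrow> p s = \<delta> s 0"
        by (rule resolvent.first_column[OF r[OF \<tau> \<delta>(1)]]) blast
      have "p \<tau> = P \<tau> \<tau>"
        by (rule stable_unique[OF A st _ _ p(2) _ P(2)])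
           (use \<tau> in \<open>auto intro!: continuous_on_subset[OF p(1)] continuous_on_subset[OF P(1)]\<close>)
      then show ?thesis using \<delta>(2) p(3)[of \<tau>] \<tau> by simp
    qed
    show "v \<tau> = (- \<i>) *\<^sub>C P \<tau> \<tau>" if "\<tau> \<in> {0..T}" for \<tau>
    proof (cases "\<tau> = 0")
      case True
      \<comment> \<open>The kernel determines \<open>v\<close> for positive lengths; the value at 0
        follows since both sides are continuous there.\<close>
      have c: "continuous_on {0..T} (\<lambda>\<tau>. v \<tau> - (- \<i>) *\<^sub>C P \<tau> \<tau>)"
        using acc by (intro continuous_on_diff cscale.continuous_on P.P_continuous_compose continuous_intros)
                     (auto simp: is_accelerant_def)
      have "((\<lambda>\<tau>. v \<tau> - (- \<i>) *\<^sub>C P \<tau> \<tau>) \<longlongrightarrow> v 0 - (- \<i>) *\<^sub>C P 0 0) (at_right 0)"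
        by (rule continuous_on_Icc_at_rightD[OF c T])
      moreover have "((\<lambda>\<tau>. v \<tau> - (- \<i>) *\<^sub>C P \<tau> \<tau>) \<longlongrightarrow> 0) (at_right 0)"
      proof (rule tendsto_eventually)
        show "\<forall>\<^sub>F \<tau> in at_right 0. v \<tau> - (- \<i>) *\<^sub>C P \<tau> \<tau> = 0"
          using T pos by (auto simp: eventually_at_right[OF T])
      qed
      ultimately have "v 0 - (- \<i>) *\<^sub>C P 0 0 = 0"
        by (rule tendsto_unique[rotated]) simp
      then show ?thesis using True by simp
    qed (use pos that in auto)
  qed
qed

subsection \<open>Block matrices\<close>

lemma sum_UNIV_Plus: "(\<Sum>i\<in>(UNIV :: ('a::finite + 'b::finite) set). f i) = (\<Sum>i\<in>UNIV. f (Inl i)) + (\<Sum>i\<in>UNIV. f (Inr i))"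
  by (simp add: UNIV_Plus_UNIV[symmetric] sum.Plus del: UNIV_Plus_UNIV)

lemma block_mult:
  "block A B C D ** block A' B' C' D'
    = block (A ** A' + B ** C') (A ** B' + B ** D') (C ** A' + D ** C') (C ** B' + D ** D')"
  by (auto simp: block_def matrix_matrix_mult_def vec_eq_iff sum_UNIV_Plus split: sum.split)

lemma block_add: "block A B C D + block A' B' C' D' = block (A + A') (B + B') (C + C') (D + D')"
  by (auto simp: block_def vec_eq_iff split: sum.split)

lemma block_scaleR: "c *\<^sub>R block A B C D = block (c *\<^sub>R A) (c *\<^sub>R B) (c *\<^sub>R C) (c *\<^sub>R D)"
  by (auto simp: block_def vec_eq_iff split: sum.split)

lemma block_cscale: "c *\<^sub>C block A B C D = block (c *\<^sub>C A) (c *\<^sub>C B) (c *\<^sub>C C) (c *\<^sub>C D)"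
  by (auto simp: block_def cscale_def vec_eq_iff split: sum.split)

lemma block_ctranspose:
  "ctranspose (block A B C D) = block (ctranspose A) (ctranspose C) (ctranspose B) (ctranspose D)"
  by (auto simp: block_def ctranspose_def vec_eq_iff split: sum.split)

lemma block_mat_1: "mat 1 = block (mat 1) 0 0 (mat 1)"
  by (auto simp: block_def mat_def vec_eq_iff split: sum.split)

lemma block_has_vector_derivative:
  assumes "(A has_vector_derivative A') (at x within S)" "(B has_vector_derivative B') (at x within S)"
    "(C has_vector_derivative C') (at x within S)" "(D has_vector_derivative D') (at x within S)"
  shows "((\<lambda>x. block (A x) (B x) (C x) (D x)) has_vector_derivative block A' B' C' D') (at x within S)"
proof -
  have "linear (\<lambda>(A, B, C, D). block A B C D)"
    by (rule linearI) (auto simp: block_add block_scaleR)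
  then have "bounded_linear (\<lambda>(A, B, C, D). block A B C D)"
    by (rule linear_conv_bounded_linear[THEN iffD1])
  from bounded_linear.has_vector_derivative[OF this has_vector_derivative_Pair[OF assms(1)
        has_vector_derivative_Pair[OF assms(2) has_vector_derivative_Pair[OF assms(3,4)]]]]
  show ?thesis by simp
qed

subsection \<open>The canonical system\<close>

lemmas mmult_has_vector_derivative = bounded_bilinear.has_vector_derivative[OF bounded_bilinear_matrix_mult]
lemmas cscale_has_vector_derivative = bounded_bilinear.has_vector_derivative[OF bounded_bilinear_cscale]
lemmas ctranspose_has_vector_derivative = bounded_linear.has_vector_derivative[OF bounded_linear_ctranspose]

lemma ctranspose_signature_j [simp]: "ctranspose signature_j = signature_j"
  by (simp add: signature_j_def block_ctranspose)

text \<open>Solved for the derivative, the upper row of the system has coefficients i z and i v, the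
  lower row -i z and -i times the adjoint of v. With v = -i P these couplings become P and its
  adjoint.\<close>

lemma canonical_equation_block:
  "(- \<i>) *\<^sub>C (signature_j ** block ((\<i> * z) *\<^sub>C a + P ** c) ((\<i> * z) *\<^sub>C b + P ** d)
      ((- \<i> * z) *\<^sub>C c + ctranspose P ** a) ((- \<i> * z) *\<^sub>C d + ctranspose P ** b))
    = z *\<^sub>C block a b c d + block 0 ((- \<i>) *\<^sub>C P) (ctranspose ((- \<i>) *\<^sub>C P)) 0 ** block a b c d"
  by (simp add: signature_j_def block_mult block_cscale block_add cscale_mult_left ctranspose_cscale mmult.minus_left)
     (auto simp: block_def cscale_def vec_eq_iff algebra_simps split: sum.split)

text \<open>The Lagrange identity: j and the potential are hermitian, and passing to the adjoint
  conjugates the spectral parameter, so the two terms of the product rule cancel.\<close>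

lemma solves_canonical_form_constant:
  assumes U: "solves_canonical T v (cnj z) U" and W: "solves_canonical T v z W" and \<tau>: "\<tau> \<in> {0..T}"
  shows "ctranspose (U \<tau>) ** signature_j ** W \<tau> = ctranspose (U 0) ** signature_j ** W 0"
proof -
  let ?H = "\<lambda>\<tau>. ctranspose (U \<tau>) ** (signature_j ** W \<tau>)"
  have "(?H has_vector_derivative 0) (at x within {0..T})" if x: "x \<in> {0..T}" for x
  proof -
    let ?V = "block 0 (v x) (ctranspose (v x)) 0"
    have V: "ctranspose ?V = ?V" by (simp add: block_ctranspose)
    obtain D where D: "(U has_vector_derivative D) (at x within {0..T})"
      "(- \<i>) *\<^sub>C (signature_j ** D) = cnj z *\<^sub>C U x + ?V ** U x"
      using U x unfolding solves_canonical_def by blast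
    obtain E where E: "(W has_vector_derivative E) (at x within {0..T})"
      "(- \<i>) *\<^sub>C (signature_j ** E) = z *\<^sub>C W x + ?V ** W x"
      using W x unfolding solves_canonical_def by blast
    have jD: "signature_j ** D = \<i> *\<^sub>C (cnj z *\<^sub>C U x + ?V ** U x)"
      unfolding D(2)[symmetric] by (simp add: cscale_cscale)
    have jE: "signature_j ** E = \<i> *\<^sub>C (z *\<^sub>C W x + ?V ** W x)"
      unfolding E(2)[symmetric] by (simp add: cscale_cscale)
    have "ctranspose D ** signature_j = ctranspose (signature_j ** D)"
      by (simp add: ctranspose_mult)
    also have "\<dots> = (- \<i>) *\<^sub>C (z *\<^sub>C ctranspose (U x) + ctranspose (U x) ** ?V)"
      by (simp add: jD ctranspose_cscale ctranspose_mult V)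
    finally have jD': "ctranspose D ** signature_j = (- \<i>) *\<^sub>C (z *\<^sub>C ctranspose (U x) + ctranspose (U x) ** ?V)" .
    have "(?H has_vector_derivative ctranspose (U x) ** (signature_j ** E) + ctranspose D ** (signature_j ** W x))
        (at x within {0..T})"
      by (intro mmult_has_vector_derivative ctranspose_has_vector_derivative D(1)
           bounded_linear.has_vector_derivative[OF mmult.bounded_linear_right] E(1))
    moreover have "ctranspose D ** (signature_j ** W x) = - (ctranspose (U x) ** (signature_j ** E))"
      unfolding matrix_mul_assoc jD'
      by (simp add: jE mmult.diff_left mmult.minus_left cscale_mult_left cscale_mult_right mmult.add_left mmult.add_right cscale.add_right
           cscale.minus_left matrix_mul_assoc flip: matrix_mul_assoc[of _ signature_j])
    ultimately show ?thesis by simp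
  qed
  then have "\<And>x. x \<in> {0..T} \<Longrightarrow> (?H has_derivative (\<lambda>h. 0)) (at x within {0..T})"
    by (simp add: has_vector_derivative_def)
  then have "\<exists>c. \<forall>x\<in>{0..T}. ?H x = c"
    by (intro has_derivative_zero_constant) auto
  then have "?H \<tau> = ?H 0" using \<tau> by auto
  then show ?thesis by (simp add: matrix_mul_assoc)
qed

lemma initial_form: "Q ** signature_j ** ctranspose Q = block 0 (mat 1) (mat 1) 0"
proof -
  have "(1 / sqrt 2 * (1 / sqrt 2)) *\<^sub>R (X + X) = X" for X :: "'a cmat"
    by (simp add: scaleR_2[symmetric])
  then show ?thesis
    by (simp add: Q_def signature_j_def block_ctranspose block_scaleR block_mult matrix_scaleR
         mmult.scaleR_left mmult.scaleR_right mmult.minus_left mmult.minus_right)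
qed

text \<open>The hypotheses range over all \<open>z\<close>, since the partner at
  \<open>cnj z\<close> enters. The constant form \<open>?X\<close> is its own inverse, so
  \<open>?X ** ?Y \<tau>\<close> is an explicit left inverse of \<open>U z \<tau>\<close>, hence
  two-sided. Any other solution W has the same product with \<open>?Y \<tau>\<close> and must
  coincide with \<open>U z\<close>.\<close>

lemma is_the_fundamental_solution_if_solves:
  assumes U: "\<And>z. solves_canonical T v z (U z)" and U0: "\<And>z. U z 0 = ctranspose Q"
  shows "is_the_fundamental_solution T v z (ctranspose Q) (U z)"
proof -
  let ?X = "block 0 (mat 1) (mat 1) 0"
  let ?Y = "\<lambda>\<tau>. ctranspose (U (cnj z) \<tau>) ** signature_j"
  have XX: "?X ** ?X = mat 1" by (simp add: block_mult block_mat_1)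
  have form: "?Y \<tau> ** W \<tau> = ?X" if "solves_canonical T v z W" "W 0 = ctranspose Q" "\<tau> \<in> {0..T}" for W \<tau>
    using solves_canonical_form_constant[OF U that(1,3)] that(2) by (simp add: U0 initial_form)
  have left: "(?X ** ?Y \<tau>) ** U z \<tau> = mat 1" if "\<tau> \<in> {0..T}" for \<tau>
    using form[OF U U0 that] XX by (simp flip: matrix_mul_assoc)
  then have right: "U z \<tau> ** (?X ** ?Y \<tau>) = mat 1" if "\<tau> \<in> {0..T}" for \<tau>
    using that matrix_left_right_inverse by blast
  have "W \<tau> = U z \<tau>" if W: "solves_canonical T v z W" "W 0 = ctranspose Q" and \<tau>: "\<tau> \<in> {0..T}" for W \<tau>
  proof -
    have "W \<tau> = (U z \<tau> ** (?X ** ?Y \<tau>)) ** W \<tau>" by (simp add: right[OF \<tau>])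
    also have "\<dots> = U z \<tau> ** (?X ** (?Y \<tau> ** W \<tau>))" by (simp add: matrix_mul_assoc)
    also have "\<dots> = U z \<tau>" by (simp only: form[OF W \<tau>] XX matrix_mul_rid)
    finally show ?thesis .
  qed
  moreover have "invertible (U z \<tau>)" if "\<tau> \<in> {0..T}" for \<tau>
    unfolding invertible_def using left[OF that] right[OF that] by blast
  ultimately show ?thesis
    using U U0 by (auto simp: is_the_fundamental_solution_def fundamental_solution_def)
qed

subsection \<open>Derivatives of theta and omega\<close>

context krein_pair
begin

text \<open>Both functions \<open>ell\<close> are treated at once: \<open>w\<close> is 2i\<lambda>,
  and \<open>d\<close> is 2 for the first and 0 for the second.\<close>

context
  fixes L :: "real \<Rightarrow> 'r cmat" and w :: complex and d :: real
  assumes L: "\<And>x. x \<in> {0..T} \<Longrightarrow> (L has_vector_derivative (w *\<^sub>C L x - d *\<^sub>R A x)) (at x within {0..T})"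
begin

lemma L_cont: "continuous_on {0..T} L"
  unfolding continuous_on_eq_continuous_within
  using L has_vector_derivative_continuous by blast

text \<open>By Krein's formula, the boundary term and the differentiated integrand share the left
  factor \<open>ctranspose (P x x)\<close>; the cofactor is the bracket of
  \<open>theta\<close>.\<close>

lemma omega_derivative:
  assumes x: "x \<in> {0..T}"
  shows "((\<lambda>\<tau>. integral {0..\<tau>} (\<lambda>s. ctranspose (P \<tau> s) ** L s)) has_vector_derivative
     ctranspose (P x x) ** (L x + integral {0..x} (\<lambda>s. ctranspose (Q x (x - s)) ** L s))) (at x within {0..T})"
proof -
  have c: "continuous_on {0..x} (\<lambda>s. ctranspose (Q x (x - s)) ** L s)"
    by (intro mmult.continuous_on continuous_on_ctranspose Q.P_continuous_compose continuous_on_subset[OF L_cont] continuous_intros)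
       (use x in auto)
  have "((\<lambda>\<tau>. integral {0..\<tau>} (\<lambda>s. ctranspose (P \<tau> s) ** L s)) has_vector_derivative
     ctranspose (P x x) ** L x + integral {0..x} (\<lambda>s. ctranspose (Q x (x - s) ** P x x) ** L s)) (at x within {0..T})"
  proof (rule leibniz_triangle[OF _ _ _ x])
    show "continuous_on {(\<tau>, s). 0 \<le> s \<and> s \<le> \<tau> \<and> \<tau> \<le> T} (\<lambda>(\<tau>, s). ctranspose (P \<tau> s) ** L s)"
      unfolding split_def
      by (intro mmult.continuous_on continuous_on_ctranspose P.P_continuous_compose
            continuous_on_compose2[OF L_cont] continuous_intros) auto
    show "continuous_on {(\<tau>, s). 0 \<le> s \<and> s \<le> \<tau> \<and> \<tau> \<le> T} (\<lambda>(\<tau>, s). ctranspose (Q \<tau> (\<tau> - s) ** P \<tau> \<tau>) ** L s)"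
      unfolding split_def
      by (intro mmult.continuous_on continuous_on_ctranspose P.P_continuous_compose Q.P_continuous_compose
            continuous_on_compose2[OF L_cont] continuous_intros) auto
    show "((\<lambda>\<tau>. ctranspose (P \<tau> s) ** L s) has_vector_derivative ctranspose (Q \<tau> (\<tau> - s) ** P \<tau> \<tau>) ** L s) (at \<tau> within {s..T})"
      if "0 \<le> s" "s \<le> \<tau>" "\<tau> \<le> T" for s \<tau>
      by (intro bounded_linear.has_vector_derivative[OF mmult.bounded_linear_left] ctranspose_has_vector_derivative P_has_derivative)
         (use that in auto)
  qed
  moreover have "integral {0..x} (\<lambda>s. ctranspose (Q x (x - s) ** P x x) ** L s)
      = ctranspose (P x x) ** integral {0..x} (\<lambda>s. ctranspose (Q x (x - s)) ** L s)"
    using integral_mmult_right[OF integrable_continuous_interval[OF c]] by (simp add: ctranspose_mult matrix_mul_assoc)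
  ultimately show ?thesis by (simp add: mmult.add_right)
qed

text \<open>Krein's formula differentiates \<open>Q \<tau> s\<close> at fixed \<open>s\<close>, so
  the integral is first reflected and the shift falls on \<open>L\<close>. The boundary term is
  \<open>P x x\<close> because \<open>L 0\<close> is the identity. The equation of
  \<open>Q x\<close> at its end point turns the terms with \<open>A\<close> into
  \<open>- d *\<^sub>R P x x\<close>; together they give the constant 1 - d in front of the
  identity.\<close>

lemma theta_derivative:
  assumes x: "x \<in> {0..T}" and PQ: "ctranspose (Q x x) = P x x" and L0: "L 0 = mat 1"
  shows "((\<lambda>\<tau>. L \<tau> + integral {0..\<tau>} (\<lambda>s. ctranspose (Q \<tau> (\<tau> - s)) ** L s)) has_vector_derivative
     w *\<^sub>C (L x + integral {0..x} (\<lambda>s. ctranspose (Q x (x - s)) ** L s))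
     + P x x ** ((1 - d) *\<^sub>R mat 1 + integral {0..x} (\<lambda>s. ctranspose (P x s) ** L s))) (at x within {0..T})"
proof -
  have adjA: "((\<lambda>\<tau>. Q \<tau> s) has_vector_derivative P \<tau> (\<tau> - s) ** Q \<tau> \<tau>) (at \<tau> within {s..T})"
    if "0 \<le> s" "s \<le> \<tau>" "\<tau> \<le> T" for s \<tau>
    using krein_pair.P_has_derivative[OF krein_pair_adj, of s \<tau>] that by simp
  have Ld: "((\<lambda>\<tau>. L (\<tau> - s)) has_vector_derivative w *\<^sub>C L (\<tau> - s) - d *\<^sub>R A (\<tau> - s)) (at \<tau> within {s..T})"
    if "0 \<le> s" "s \<le> \<tau>" "\<tau> \<le> T" for s \<tau>
  proof -
    have "(L \<circ> (\<lambda>\<tau>. \<tau> - s) has_vector_derivative 1 *\<^sub>R (w *\<^sub>C L (\<tau> - s) - d *\<^sub>R A (\<tau> - s))) (at \<tau> within {s..T})"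
    proof (rule vector_diff_chain_within)
      show "((\<lambda>\<tau>. \<tau> - s) has_vector_derivative 1) (at \<tau> within {s..T})"
        by (auto intro!: derivative_eq_intros)
      show "(L has_vector_derivative w *\<^sub>C L (\<tau> - s) - d *\<^sub>R A (\<tau> - s)) (at (\<tau> - s) within (\<lambda>\<tau>. \<tau> - s) ` {s..T})"
        by (rule has_vector_derivative_within_subset[OF L]) (use that in auto)
    qed
    then show ?thesis by (simp add: o_def)
  qed
  note Lc = continuous_on_compose2[OF L_cont] and Ac = continuous_on_compose2[OF P.A_cont]
  let ?\<Psi> = "\<lambda>\<tau> s. ctranspose (Q \<tau> s) ** (w *\<^sub>C L (\<tau> - s) - d *\<^sub>R A (\<tau> - s)) + ctranspose (P \<tau> (\<tau> - s) ** Q \<tau> \<tau>) ** L (\<tau> - s)"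
  have der: "((\<lambda>\<tau>. integral {0..\<tau>} (\<lambda>s. ctranspose (Q \<tau> s) ** L (\<tau> - s))) has_vector_derivative
     ctranspose (Q x x) ** L (x - x) + integral {0..x} (?\<Psi> x)) (at x within {0..T})"
  proof (rule leibniz_triangle[OF _ _ _ x])
    show "continuous_on {(\<tau>, s). 0 \<le> s \<and> s \<le> \<tau> \<and> \<tau> \<le> T} (\<lambda>(\<tau>, s). ctranspose (Q \<tau> s) ** L (\<tau> - s))"
      unfolding split_def
      by (intro mmult.continuous_on continuous_on_ctranspose Q.P_continuous_compose Lc continuous_intros) auto
    show "continuous_on {(\<tau>, s). 0 \<le> s \<and> s \<le> \<tau> \<and> \<tau> \<le> T} (\<lambda>(\<tau>, s). ?\<Psi> \<tau> s)"
      unfolding split_def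
      by (intro continuous_on_add continuous_on_diff mmult.continuous_on cscale.continuous_on continuous_on_ctranspose
            P.P_continuous_compose Q.P_continuous_compose Lc Ac continuous_intros) auto
    show "((\<lambda>\<tau>. ctranspose (Q \<tau> s) ** L (\<tau> - s)) has_vector_derivative ?\<Psi> \<tau> s) (at \<tau> within {s..T})"
      if "0 \<le> s" "s \<le> \<tau>" "\<tau> \<le> T" for s \<tau>
      by (intro mmult_has_vector_derivative ctranspose_has_vector_derivative adjA Ld that)
  qed
  let ?I = "\<lambda>\<tau>. integral {0..\<tau>} (\<lambda>s. ctranspose (Q \<tau> (\<tau> - s)) ** L s)"
  have refl: "integral {0..\<tau>} (\<lambda>s. ctranspose (Q \<tau> s) ** L (\<tau> - s)) = ?I \<tau>" for \<tau>
    using integral_reflect_Icc[of \<tau> "\<lambda>s. ctranspose (Q \<tau> (\<tau> - s)) ** L s"] by simp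
  have "integral {0..x} (?\<Psi> x) = w *\<^sub>C ?I x - d *\<^sub>R (P x x - A x) + P x x ** integral {0..x} (\<lambda>s. ctranspose (P x s) ** L s)"
  proof -
    have c1: "(\<lambda>s. ctranspose (Q x s) ** L (x - s)) integrable_on {0..x}"
      by (intro integrable_continuous_interval mmult.continuous_on continuous_on_ctranspose Q.P_continuous_compose Lc continuous_intros)
         (use x in auto)
    have c2: "(\<lambda>s. ctranspose (Q x s) ** A (x - s)) integrable_on {0..x}"
      by (intro integrable_continuous_interval mmult.continuous_on continuous_on_ctranspose Q.P_continuous_compose Ac continuous_intros)
         (use x in auto)
    have c3: "(\<lambda>s. ctranspose (P x (x - s)) ** L (x - s)) integrable_on {0..x}"
      by (intro integrable_continuous_interval mmult.continuous_on continuous_on_ctranspose P.P_continuous_compose Lc continuous_intros)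
         (use x in auto)
    have i1: "((\<lambda>s. w *\<^sub>C (ctranspose (Q x s) ** L (x - s))) has_integral (w *\<^sub>C ?I x)) {0..x}"
      using has_integral_linear[OF integrable_integral[OF c1] cscale.bounded_linear_right[of w]] by (simp add: o_def refl)
    have i3: "((\<lambda>s. P x x ** (ctranspose (P x (x - s)) ** L (x - s))) has_integral
        (P x x ** integral {0..x} (\<lambda>s. ctranspose (P x s) ** L s))) {0..x}"
      using has_integral_linear[OF integrable_integral[OF c3] mmult.bounded_linear_right[of "P x x"]]
        integral_reflect_Icc[of x "\<lambda>s. ctranspose (P x s) ** L s"] by (simp add: o_def)
    \<comment> \<open>At the end point x all differences x - s are nonnegative, so this integral is
      the adjoint of a convolution that the equation for \<open>Q x\<close> evaluates.\<close>
    have i2: "integral {0..x} (\<lambda>s. ctranspose (Q x s) ** A (x - s)) = P x x - A x"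
    proof -
      have i: "(\<lambda>s. herm_kernel (adj A) (x - s) ** Q x s) integrable_on {0..x}"
        by (intro conv_split(1) Q.A_cont continuous_on_subset[OF Q.P_cont]) (use x in auto)
      have "integral {0..x} (\<lambda>s. ctranspose (Q x s) ** A (x - s)) = integral {0..x} (\<lambda>s. ctranspose (herm_kernel (adj A) (x - s) ** Q x s))"
        by (rule integral_cong) (auto simp: herm_kernel_def ctranspose_mult)
      also have "\<dots> = ctranspose (conv (adj A) x (Q x) x)"
        unfolding conv_def by (rule integral_ctranspose[OF i])
      also have "conv (adj A) x (Q x) x = Q x x - ctranspose (A x)"
        using Q.P_eq[OF x x] by (simp add: algebra_simps)
      finally show ?thesis by (simp add: PQ)
    qed
    have i2': "((\<lambda>s. d *\<^sub>R (ctranspose (Q x s) ** A (x - s))) has_integral (d *\<^sub>R (P x x - A x))) {0..x}"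
      using has_integral_cmul[OF integrable_integral[OF c2], of d] by (simp add: i2)
    have "(?\<Psi> x has_integral (w *\<^sub>C ?I x - d *\<^sub>R (P x x - A x) + P x x ** integral {0..x} (\<lambda>s. ctranspose (P x s) ** L s))) {0..x}"
      using has_integral_add[OF has_integral_diff[OF i1 i2'] i3]
      by (simp add: mmult.diff_right cscale_mult_right mmult.scaleR_right ctranspose_mult PQ matrix_mul_assoc)
    then show ?thesis by (rule integral_unique)
  qed
  moreover note has_vector_derivative_add[OF L[OF x] der[unfolded refl]]
  ultimately have "((\<lambda>\<tau>. L \<tau> + ?I \<tau>) has_vector_derivative (w *\<^sub>C L x - d *\<^sub>R A x) + (P x x +
      (w *\<^sub>C ?I x - d *\<^sub>R (P x x - A x) + P x x ** integral {0..x} (\<lambda>s. ctranspose (P x s) ** L s)))) (at x within {0..T})"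
    by (simp add: PQ L0)
  moreover have "(w *\<^sub>C L x - d *\<^sub>R A x) + (P x x + (w *\<^sub>C ?I x - d *\<^sub>R (P x x - A x) + P x x ** J))
      = w *\<^sub>C (L x + ?I x) + P x x ** ((1 - d) *\<^sub>R mat 1 + J)" for J
    by (simp add: mmult.add_right mmult.diff_right mmult.scaleR_right cscale.add_right scaleR_diff_right scaleR_diff_left algebra_simps)
  ultimately show ?thesis by simp
qed

end

end

text \<open>\<open>ell1\<close> is the variation of constants solution with inhomogeneity -2k,
  \<open>ell2\<close> the solution of the homogeneous equation; both start at the identity.\<close>

lemma ell_derivative:
  assumes k: "continuous_on {0..T} k" and x: "x \<in> {0..T}"
  shows "((\<lambda>x. ell k m x z) has_vector_derivative ((2 * \<i> * z) *\<^sub>C ell k m x z - (if m = 1 then 2 else 0) *\<^sub>R k x)) (at x within {0..T})"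
proof -
  have e: "((\<lambda>x :: real. exp (2 * \<i> * z * x)) has_vector_derivative (2 * \<i> * z) * exp (2 * \<i> * z * x)) (at x within {0..T})"
    by (auto intro!: derivative_eq_intros has_vector_derivative_real_field)
  show ?thesis
  proof (cases "m = 1")
    case True
    have c: "continuous_on {0..T} (\<lambda>t. exp (- 2 * \<i> * z * t) *\<^sub>C k t)"
      by (intro cscale.continuous_on k continuous_intros)
    have i: "((\<lambda>x. mat 1 - 2 *\<^sub>R integral {0..x} (\<lambda>t. exp (- 2 * \<i> * z * t) *\<^sub>C k t)) has_vector_derivative
        0 - 2 *\<^sub>R (exp (- 2 * \<i> * z * x) *\<^sub>C k x)) (at x within {0..T})"
      by (intro has_vector_derivative_diff has_vector_derivative_const
           bounded_linear.has_vector_derivative[OF bounded_linear_scaleR_right] integral_has_vector_derivative[OF c x])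
    have ee: "exp (2 * \<i> * z * x) * exp (- 2 * \<i> * z * x) = 1"
      by (simp flip: exp_add)
    show ?thesis
      using cscale_has_vector_derivative[OF e i] ee True
      by (simp add: ell_def ell1_def cscale_cscale cscale.scaleR_right cscale.minus_right)
  next
    case False
    show ?thesis
      using cscale_has_vector_derivative[OF e has_vector_derivative_const[of "mat 1"]] False
      by (simp add: ell_def ell2_def cscale_cscale cscale.zero_right)
  qed
qed

lemma ell_zero: "ell k m 0 z = mat 1"
  by (simp add: ell_def ell1_def ell2_def)

theorem theorem2p1:
  fixes k :: "real \<Rightarrow> complex ^ 'r::finite ^ 'r"
    and v :: "real \<Rightarrow> complex ^ 'r ^ 'r"
    and \<gamma> :: "real \<Rightarrow> real \<Rightarrow> real \<Rightarrow> complex ^ 'r ^ 'r"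
    and T :: real
  assumes "T > 0"
    and "is_accelerant T k v"
    and "\<And>\<tau>. \<tau> \<in> {0<..T} \<Longrightarrow> is_resolvent_kernel k \<tau> (\<gamma> \<tau>)"
  shows "\<forall>z. is_the_fundamental_solution T v z (ctranspose Q) (\<lambda>\<tau>. u_sol k \<gamma> \<tau> z)"
proof -
  obtain A C P R where pair: "krein_pair A T C P R" and A: "\<And>x. x \<in> {0..T} \<Longrightarrow> A x = k x"
    and \<gamma>0: "\<And>\<tau> s. \<tau> \<in> {0<..T} \<Longrightarrow> s \<in> {0<..\<tau>} \<Longrightarrow> \<gamma> \<tau> 0 s = ctranspose (P \<tau> s)"
    and \<gamma>\<tau>: "\<And>\<tau> s. \<tau> \<in> {0<..T} \<Longrightarrow> s \<in> {0..<\<tau>} \<Longrightarrow> \<gamma> \<tau> \<tau> s = ctranspose (R \<tau> (\<tau> - s))"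
    and PR: "\<And>\<tau>. \<tau> \<in> {0..T} \<Longrightarrow> ctranspose (R \<tau> \<tau>) = P \<tau> \<tau>"
    and v: "\<And>\<tau>. \<tau> \<in> {0..T} \<Longrightarrow> v \<tau> = (- \<i>) *\<^sub>C P \<tau> \<tau>"
    by (rule accelerant_krein_pair[OF assms]) (assumption, rule that)
  have k: "continuous_on {0..T} k" using assms(2) by (simp add: is_accelerant_def)
  let ?d = "\<lambda>m :: nat. if m = 1 then 2 else 0 :: real"
  \<comment> \<open>This prefactor satisfies c' = -i z c and thereby lowers both diagonal
    coefficients by i z: 2i z becomes i z and 0 becomes -i z.\<close>
  define c where "c z \<tau> = (1 / sqrt 2) *\<^sub>R exp (- \<i> * of_real \<tau> * z)" for z and \<tau> :: real
  define \<theta> where "\<theta> m z \<tau> = ell k m \<tau> z + integral {0..\<tau>} (\<lambda>s. ctranspose (R \<tau> (\<tau> - s)) ** ell k m s z)" for m z \<tau>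
  \<comment> \<open>For m = 1, 2 the number 1 - d is -1 and 1, that is (-1)^m; in this form it
    matches the constant produced by differentiating \<theta>.\<close>
  define \<omega> where "\<omega> m z \<tau> = (1 - ?d m) *\<^sub>R mat 1 + integral {0..\<tau>} (\<lambda>s. ctranspose (P \<tau> s) ** ell k m s z)" for m z \<tau>
  have L: "((\<lambda>x. ell k m x z) has_vector_derivative ((2 * \<i> * z) *\<^sub>C ell k m x z - ?d m *\<^sub>R A x)) (at x within {0..T})"
    if "x \<in> {0..T}" for m z x
    using ell_derivative[OF k that] by (simp add: A[OF that])
  have theta: "theta k \<gamma> m \<tau> z = c z \<tau> *\<^sub>C \<theta> m z \<tau>" if "\<tau> \<in> {0..T}" for m \<tau> z
  proof -
    \<comment> \<open>The symmetry relation leaves out the diagonal, here the single point s =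
      \<tau>; in the row of \<open>omega\<close> it is s = 0.\<close>
    have "integral {0..\<tau>} (\<lambda>s. \<gamma> \<tau> \<tau> s ** ell k m s z) = integral {0..\<tau>} (\<lambda>s. ctranspose (R \<tau> (\<tau> - s)) ** ell k m s z)"
    proof (cases "\<tau> = 0")
      case False
      then show ?thesis by (intro integral_spike[of "{\<tau>}"]) (use that \<gamma>\<tau>[of \<tau>] in auto)
    qed simp
    then show ?thesis by (simp add: theta_def \<theta>_def c_def cscale.scaleR_left)
  qed
  have omega: "omega k \<gamma> m \<tau> z = c z \<tau> *\<^sub>C \<omega> m z \<tau>" if "\<tau> \<in> {0..T}" "m \<in> {1, 2}" for m \<tau> z
  proof -
    have "integral {0..\<tau>} (\<lambda>s. \<gamma> \<tau> 0 s ** ell k m s z) = integral {0..\<tau>} (\<lambda>s. ctranspose (P \<tau> s) ** ell k m s z)"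
    proof (cases "\<tau> = 0")
      case False
      then show ?thesis by (intro integral_spike[of "{0}"]) (use that \<gamma>0[of \<tau>] in auto)
    qed simp
    moreover have "(- 1) ^ m *\<^sub>C mat 1 = (1 - ?d m) *\<^sub>R (mat 1 :: 'r cmat)"
      using that(2) by (auto simp: cscale.minus_left)
    ultimately show ?thesis by (simp add: omega_def \<omega>_def c_def cscale.scaleR_left)
  qed
  have dc: "((\<lambda>\<tau>. c z \<tau>) has_vector_derivative (- \<i> * z) * c z x) (at x within {0..T})" for z x
    unfolding c_def by (auto intro!: derivative_eq_intros has_vector_derivative_real_field)
  have d\<theta>: "((\<lambda>\<tau>. c z \<tau> *\<^sub>C \<theta> m z \<tau>) has_vector_derivative
      (\<i> * z) *\<^sub>C (c z x *\<^sub>C \<theta> m z x) + P x x ** (c z x *\<^sub>C \<omega> m z x)) (at x within {0..T})"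
    if x: "x \<in> {0..T}" for m z x
  proof -
    have "(\<theta> m z has_vector_derivative (2 * \<i> * z) *\<^sub>C \<theta> m z x + P x x ** \<omega> m z x) (at x within {0..T})"
      unfolding \<theta>_def[abs_def] \<omega>_def
      by (rule krein_pair.theta_derivative[OF pair L x PR[OF x] ell_zero])
    from cscale_has_vector_derivative[OF dc this]
    have "((\<lambda>\<tau>. c z \<tau> *\<^sub>C \<theta> m z \<tau>) has_vector_derivative
      c z x *\<^sub>C ((2 * \<i> * z) *\<^sub>C \<theta> m z x + P x x ** \<omega> m z x) + ((- \<i> * z) * c z x) *\<^sub>C \<theta> m z x) (at x within {0..T})" .
    moreover have "c z x *\<^sub>C ((2 * \<i> * z) *\<^sub>C \<theta> m z x + P x x ** \<omega> m z x) + ((- \<i> * z) * c z x) *\<^sub>C \<theta> m z x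
        = (c z x * (2 * \<i> * z) + (- \<i> * z) * c z x) *\<^sub>C \<theta> m z x + P x x ** (c z x *\<^sub>C \<omega> m z x)"
      by (simp only: cscale.add_right cscale.add_left cscale_cscale cscale_mult_right add_ac)
    moreover have "c z x * (2 * \<i> * z) + (- \<i> * z) * c z x = \<i> * z * c z x" by (simp add: algebra_simps)
    ultimately show ?thesis by (simp only: cscale_cscale)
  qed
  have d\<omega>: "((\<lambda>\<tau>. c z \<tau> *\<^sub>C \<omega> m z \<tau>) has_vector_derivative
      (- \<i> * z) *\<^sub>C (c z x *\<^sub>C \<omega> m z x) + ctranspose (P x x) ** (c z x *\<^sub>C \<theta> m z x)) (at x within {0..T})"
    if x: "x \<in> {0..T}" for m z x
  proof -
    have "(\<omega> m z has_vector_derivative 0 + ctranspose (P x x) ** \<theta> m z x) (at x within {0..T})"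
      unfolding \<theta>_def \<omega>_def[abs_def]
      by (intro has_vector_derivative_add has_vector_derivative_const krein_pair.omega_derivative[OF pair L x])
    from cscale_has_vector_derivative[OF dc this] show ?thesis
      by (simp add: cscale_cscale cscale_mult_right add.commute)
  qed
  have solves: "solves_canonical T v z (\<lambda>\<tau>. u_sol k \<gamma> \<tau> z)" for z
    unfolding solves_canonical_def
  proof (intro ballI exI conjI)
    fix x assume x: "x \<in> {0..T}"
    let ?\<theta>' = "\<lambda>m. (\<i> * z) *\<^sub>C (c z x *\<^sub>C \<theta> m z x) + P x x ** (c z x *\<^sub>C \<omega> m z x)"
    let ?\<omega>' = "\<lambda>m. (- \<i> * z) *\<^sub>C (c z x *\<^sub>C \<omega> m z x) + ctranspose (P x x) ** (c z x *\<^sub>C \<theta> m z x)"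
    have u: "u_sol k \<gamma> \<tau> z = block (c z \<tau> *\<^sub>C \<theta> 1 z \<tau>) (c z \<tau> *\<^sub>C \<theta> 2 z \<tau>) (c z \<tau> *\<^sub>C \<omega> 1 z \<tau>) (c z \<tau> *\<^sub>C \<omega> 2 z \<tau>)"
      if "\<tau> \<in> {0..T}" for \<tau>
      using that by (simp add: u_sol_def theta omega)
    have "((\<lambda>\<tau>. block (c z \<tau> *\<^sub>C \<theta> 1 z \<tau>) (c z \<tau> *\<^sub>C \<theta> 2 z \<tau>) (c z \<tau> *\<^sub>C \<omega> 1 z \<tau>) (c z \<tau> *\<^sub>C \<omega> 2 z \<tau>))
       has_vector_derivative block (?\<theta>' 1) (?\<theta>' 2) (?\<omega>' 1) (?\<omega>' 2)) (at x within {0..T})"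
      by (intro block_has_vector_derivative d\<theta> d\<omega> x)
    then show "((\<lambda>\<tau>. u_sol k \<gamma> \<tau> z) has_vector_derivative block (?\<theta>' 1) (?\<theta>' 2) (?\<omega>' 1) (?\<omega>' 2)) (at x within {0..T})"
      by (rule has_vector_derivative_transform[OF x, rotated]) (rule u)
    show "(- \<i>) *\<^sub>C (signature_j ** block (?\<theta>' 1) (?\<theta>' 2) (?\<omega>' 1) (?\<omega>' 2))
      = z *\<^sub>C u_sol k \<gamma> x z + block 0 (v x) (ctranspose (v x)) 0 ** u_sol k \<gamma> x z"
      unfolding u[OF x] v[OF x] by (rule canonical_equation_block)
  qed
  \<comment> \<open>At \<tau> = 0 the integrals vanish and the constants I, I, -I, I with the factor
    1/sqrt 2 are the blocks of the adjoint of \<open>Q\<close>.\<close>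
  have "u_sol k \<gamma> 0 z = ctranspose Q" for z
  proof -
    have "c z 0 *\<^sub>C X = (1 / sqrt 2) *\<^sub>R X" for X :: "'r cmat"
      by (simp add: c_def cscale_def vec_eq_iff scaleR_conv_of_real[symmetric])
    then show ?thesis
      using assms(1)
      by (simp add: u_sol_def theta omega \<theta>_def \<omega>_def ell_zero Q_def block_ctranspose block_scaleR)
  qed
  then show ?thesis
    using is_the_fundamental_solution_if_solves[of T v "\<lambda>z \<tau>. u_sol k \<gamma> \<tau> z", OF solves] by blast
qed

end
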